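(* Let $p$ be a prime with $p\equiv1\pmod3$, $q=p$, $s=3$, $h\in\{0,1,2\}$, $m\ge2$, $a\in\mathbb{F}_p$, $t\mid m$, $d=\gcd(m/t,3)$, and assume $p\nmid m/t$ and $d\mid h$. Let $i_0$ be the unique integer with $0\le i_0<3/d$ and $\frac{m}{dt}i_0\equiv\frac hd\pmod{3/d}$, and (for $a\neq0$) $a_0=-\frac{m}{ta}$. For $3\nmid t$ define $$Q_{t,3}=\begin{cases}p^{(t-1)/3}\pi_3^{(t-1)/3}\,\bar\chi_3(a_0)\,\zeta^{2i_0}&t\equiv1\pmod3,\\ p^{(t-2)/3}\pi_3^{(t+1)/3}\,\chi_3(a_0)\,\zeta^{2i_0}&t\equiv2\pmod3.\end{cases}$$ Then: for $a=0$, $N_t=\frac13(p^{t-1}-1)$ if $3\nmid m/t$, $3\nmid t$; $N_t=\frac13\bigl(p^{t-1}-1-2(-1)^tp^{(t-3)/3}(p-1)\mathrm{Re}(\pi_3^{t/3}\zeta^{2i_0})\bigr)$ if $3\nmid m/t$, $3\mid t$; $N_t=p^{t-1}-1$ if $3\mid m/t$. For $a\neq0$, $N_t=\frac13\bigl(p^{t-1}-2(-1)^t\mathrm{Re}\,Q_{t,3}\bigr)$ if $3\nmid m/t$, $3\nmid t$; $N_t=\frac13\bigl(p^{t-1}+2(-1)^tp^{(t-3)/3}\mathrm{Re}(\pi_3^{t/3}\zeta^{2i_0})\bigr)$ if $3\nmid m/t$, $3\mid t$; $N_t=p^{t-1}$ if $3\mid m/t$.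
   Context: $\mathrm{Tr}_m,\mathrm{Nm}_m$ are trace and norm from $\mathbb{F}_{p^m}$ to $\mathbb{F}_p$; $\gamma_m$ is a fixed primitive element of $\mathbb{F}_{p^m}$, $g=\mathrm{Nm}_m(\gamma_m)$. $N_t$ is the number of $x\in\mathbb{F}_{p^t}$ with $\mathrm{Tr}_m(x)=a$ and $\mathrm{Nm}_m(x)\in g^h\langle g^3\rangle$. $\zeta=e^{2\pi i/3}$; $\chi_3$ is the multiplicative character of order 3 of $\mathbb{F}_p$ with $\chi_3(g)=\zeta$, $\bar\chi_3$ its conjugate. Let $a_3,b_3$ be integers with $a_3^2+3b_3^2=p$, $a_3\equiv-1\pmod3$, $3b_3\equiv(2g^{(p-1)/3}+1)a_3\pmod p$, and $\pi_3=\chi_3(2)(a_3+ib_3\sqrt3)$. *)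

theory Defs
  imports Complex_Main "HOL-Library.Cardinality" "HOL-Number_Theory.Number_Theory"
begin

text \<open>
  The field with \<open>p\<^sup>m\<close> elements is a type of class \<open>finite_field\<close> and cardinality \<open>p\<^sup>m\<close>.
  The fields with \<open>p\<^sup>t\<close> elements, \<open>t\<close> dividing \<open>m\<close>, and in particular the prime field, are
  subfields of it, given as sets.
\<close>

definition is_subfield :: "'a::field set \<Rightarrow> bool" where
  "is_subfield K \<longleftrightarrow> 0 \<in> K \<and> 1 \<in> K \<and>
     (\<forall>x\<in>K. \<forall>y\<in>K. x + y \<in> K \<and> x * y \<in> K) \<and> (\<forall>x\<in>K. - x \<in> K \<and> inverse x \<in> K)"

text \<open>
  Trace and norm from the field with \<open>p\<^sup>m\<close> elements to its prime field, as the sum and the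
  product of the conjugates \<open>x, x\<^sup>p, \<dots>\<close> under the Frobenius automorphism.
\<close>

definition ff_trace :: "nat \<Rightarrow> nat \<Rightarrow> 'a::field \<Rightarrow> 'a" where
  "ff_trace p m x = (\<Sum>j<m. x ^ (p ^ j))"

definition ff_norm :: "nat \<Rightarrow> nat \<Rightarrow> 'a::field \<Rightarrow> 'a" where
  "ff_norm p m x = (\<Prod>j<m. x ^ (p ^ j))"

definition primitive_element :: "'a::field \<Rightarrow> bool" where
  "primitive_element \<gamma> \<longleftrightarrow> \<gamma> \<noteq> 0 \<and> (\<forall>x. x \<noteq> 0 \<longrightarrow> (\<exists>k::int. x = \<gamma> powi k))"

definition power_coset :: "'a::field \<Rightarrow> nat \<Rightarrow> nat \<Rightarrow> 'a set" where
  "power_coset g s h = {g ^ h * (g ^ s) powi k |k::int. True}"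

definition N_count :: "nat \<Rightarrow> nat \<Rightarrow> 'a::field \<Rightarrow> nat \<Rightarrow> nat \<Rightarrow> 'a \<Rightarrow> 'a set \<Rightarrow> nat" where
  "N_count p m g s h a K = card {x \<in> K. ff_trace p m x = a \<and> ff_norm p m x \<in> power_coset g s h}"

text \<open>Multiplicative characters of a subfield \<open>F\<close>, extended by \<open>0\<close> at the element \<open>0\<close>.\<close>

definition mult_character :: "'a::field set \<Rightarrow> ('a \<Rightarrow> complex) \<Rightarrow> bool" where
  "mult_character F \<chi> \<longleftrightarrow> \<chi> 0 = 0 \<and> \<chi> 1 = 1 \<and> (\<forall>x\<in>F. \<forall>y\<in>F. \<chi> (x * y) = \<chi> x * \<chi> y)"

definition character_order :: "'a::field set \<Rightarrow> ('a \<Rightarrow> complex) \<Rightarrow> nat" where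
  "character_order F \<chi> = (LEAST k. 0 < k \<and> (\<forall>x\<in>F - {0}. \<chi> x ^ k = 1))"

definition zeta3 :: complex where
  "zeta3 = exp (2 * of_real pi * \<i> / 3)"

text \<open>Only meaningful for \<open>t\<close> not divisible by \<open>3\<close>: the second branch is the case \<open>t mod 3 = 2\<close>.\<close>

definition Q3 :: "nat \<Rightarrow> complex \<Rightarrow> ('a::field \<Rightarrow> complex) \<Rightarrow> 'a \<Rightarrow> nat \<Rightarrow> nat \<Rightarrow> complex" where
  "Q3 p \<pi>\<^sub>3 \<chi> a\<^sub>0 i\<^sub>0 t =
     (if t mod 3 = 1
      then of_nat p ^ ((t - 1) div 3) * \<pi>\<^sub>3 ^ ((t - 1) div 3) * cnj (\<chi> a\<^sub>0) * zeta3 ^ (2 * i\<^sub>0)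
      else of_nat p ^ ((t - 2) div 3) * \<pi>\<^sub>3 ^ ((t + 1) div 3) * \<chi> a\<^sub>0 * zeta3 ^ (2 * i\<^sub>0))"

end

(* The counting problem reduces to the sums S_t(c) of chi(Nm x) over the x in F_(p^t) with Tr x = c,
where chi is the cubic character.  In the group ring of the additive group of F_p over the complex
numbers put G = sum_u chi(u) [u].  Attaching to a monic f over F_p the weight [tr f] * chi(f(0)), which is
multiplicative, gives an L-function equal to the polynomial 1 + G T, since the weights of the monic
polynomials of each degree >= 2 cancel.  Its Euler product, differentiated logarithmically, says that
sum_c S_t(c) [c] = (-1)^(t-1) G^t (Hasse and Davenport, with the additive character left generic).
The powers of G follow from G^2 = J sum_c chi(c)^2 [c] and G^4 = p J G with the Jacobi sum J.
Finally chi(4) J = sum_v chi(1 - v^2), and the symmetry v -> -v, the absolute value, the degree of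
(1 - x^2)^((p-1)/3) and the number of summands force chi(4) J = a_3 + i b_3 sqrt 3. *)

theory Submission
  imports Defs "Berlekamp_Zassenhaus.Distinct_Degree_Factorization" "HOL-Library.Poly_Mapping"
begin

section \<open>Weighted counts of monic polynomials\<close>

text \<open>On F_(p^t) the trace of the big field is m/t times the trace from F_(p^t), and the norm
  is the (m/t)-th power of the norm from F_(p^t). As p does not divide m/t, the trace condition
  prescribes the smaller trace as c = a/(m/t). For x nonzero the norm condition reads chi(Nm
  x)^(m/t) = zeta^h, which is automatic if 3 divides m/t and otherwise pins chi(Nm x) to zeta^i_0.
  Only S_t(c) at this one c is then needed. With a generic additive character it is literally a
  coefficient in the group ring, so no Fourier inversion over the additive characters of F_p is
  needed. The price is a ring with zero divisors: identities are compared coefficientwise and the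
  logarithmic derivative is a recurrence without division. Nor is G invertible, because chi sums to
  0 and so G is annihilated by the sum of all [c]. Thus G^3 = J (p [0] - sum_c [c]) is not a scalar;
  it acts as p J only on multiples of G. This is why the case 3 | t is special: it has the exponent
  (t-3)/3 of p and the factor p - 1 or -1 according to whether a is 0.\<close>

definition monics :: "nat \<Rightarrow> 'b::{finite, field_gcd} poly set" where
  "monics n = {f. monic f \<and> degree f = n}"

definition prime_monics :: "nat \<Rightarrow> 'b::{finite, field_gcd} poly set" where
  "prime_monics n = {f \<in> monics n. irreducible f}"

lemma monicsD: "f \<in> monics n \<Longrightarrow> monic f" "f \<in> monics n \<Longrightarrow> degree f = n"
  by (auto simp: monics_def)

text \<open>The coefficients below the leading one are free; what is drawn from this is the
  finiteness of \<open>monics n\<close>, without which sums over it would be void.\<close>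

lemma bij_betw_monics_coeffs:
  "bij_betw (\<lambda>f. restrict (coeff f) {..<n})
     (monics n :: 'b::{finite, field_gcd} poly set) ({..<n} \<rightarrow>\<^sub>E UNIV)"
proof (rule bij_betw_byWitness[where f' = "\<lambda>c. monom 1 n + (\<Sum>i<n. monom (c i) i)"])
  have coeff: "coeff (monom 1 n + (\<Sum>i<n. monom (c i) i)) k =
      (if k = n then 1 else if k < n then c k else (0::'b))" for c k
    by (auto simp: coeff_sum coeff_monom sum.delta)
  have deg: "degree (monom 1 n + (\<Sum>i<n. monom (c i) i) :: 'b poly) = n" for c :: "nat \<Rightarrow> 'b"
  proof (rule antisym)
    show "degree (monom 1 n + (\<Sum>i<n. monom (c i) i) :: 'b poly) \<le> n"
      by (rule degree_le) (simp add: coeff del: coeff_add)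
    show "n \<le> degree (monom 1 n + (\<Sum>i<n. monom (c i) i) :: 'b poly)"
      by (rule le_degree) (simp add: coeff del: coeff_add)
  qed
  show "\<forall>f\<in>monics n. monom 1 n + (\<Sum>i<n. monom (restrict (coeff f) {..<n} i) i) = (f :: 'b poly)"
  proof
    fix f :: "'b poly" assume f: "f \<in> monics n"
    show "monom 1 n + (\<Sum>i<n. monom (restrict (coeff f) {..<n} i) i) = f"
      using f by (intro poly_eqI) (auto simp: coeff monics_def coeff_eq_0 simp del: coeff_add)
  qed
  show "\<forall>c\<in>{..<n} \<rightarrow>\<^sub>E UNIV. restrict (coeff (monom 1 n + (\<Sum>i<n. monom (c i) i) :: 'b poly)) {..<n} = c"
    by (auto simp: coeff fun_eq_iff PiE_def extensional_def simp del: coeff_add)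
  show "(\<lambda>f. restrict (coeff f) {..<n}) ` (monics n :: 'b poly set) \<subseteq> {..<n} \<rightarrow>\<^sub>E UNIV"
    by (auto simp: PiE_def)
  show "(\<lambda>c. monom 1 n + (\<Sum>i<n. monom (c i) i)) ` ({..<n} \<rightarrow>\<^sub>E UNIV) \<subseteq> (monics n :: 'b poly set)"
    unfolding monics_def using deg coeff[where k = n] by fastforce
qed

lemma finite_monics [simp, intro]: "finite (monics n :: 'b::{finite, field_gcd} poly set)"
  using bij_betw_finite[OF bij_betw_monics_coeffs[where ?'b = 'b and n = n]]
  by (simp add: finite_PiE)

lemma finite_prime_monics [simp, intro]: "finite (prime_monics n :: 'b::{finite, field_gcd} poly set)"
  by (simp add: prime_monics_def)

lemma monics_0: "monics 0 = {1 :: 'b::{finite, field_gcd} poly}"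
  unfolding monics_def using monic_degree_0 by auto

lemma monics_1: "monics 1 = range (\<lambda>u :: 'b::{finite, field_gcd}. [:- u, 1:])"
proof safe
  fix f :: "'b poly" assume f: "f \<in> monics 1"
  then obtain a b where ab: "f = [:a, b:]"
    using degree1_coeffs[of f] by (auto simp: monics_def) blast
  with f have "b = 1" by (auto simp: monics_def split: if_splits)
  with ab show "f \<in> range (\<lambda>u. [:- u, 1:])"
    by (auto intro!: image_eqI[of _ _ "-a"])
qed (auto simp: monics_def)

lemma monics_mult: "f \<in> monics m \<Longrightarrow> h \<in> monics n \<Longrightarrow> f * h \<in> monics (m + n)"
  unfolding monics_def using degree_mult_eq[of f h] monic_mult[of f h] by force

lemma monics_power: "f \<in> monics m \<Longrightarrow> f ^ j \<in> monics (m * j)"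
  by (induction j) (auto simp: monics_0 monics_mult)

lemma monics_multiples:
  fixes f :: "'b::{finite, field_gcd} poly"
  assumes f: "f \<in> monics m" and "m \<le> n"
  shows "{h \<in> monics n. f dvd h} = (*) f ` monics (n - m)"
proof (intro equalityI subsetI)
  fix h assume "h \<in> {h \<in> monics n. f dvd h}"
  then obtain r where h: "h = f * r" and fr: "f * r \<in> monics n" by (auto simp: dvd_def)
  have "f \<noteq> 0" "r \<noteq> 0" using monicsD[OF f] monicsD[OF fr] by auto
  hence "degree (f * r) = degree f + degree r" by (rule degree_mult_eq)
  moreover have "lead_coeff (f * r) = lead_coeff f * lead_coeff r" by (rule lead_coeff_mult)
  ultimately have "r \<in> monics (n - m)"
    using monicsD[OF f] monicsD[OF fr] by (simp add: monics_def)
  thus "h \<in> (*) f ` monics (n - m)" using h by blast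
next
  fix h assume "h \<in> (*) f ` monics (n - m)"
  thus "h \<in> {h \<in> monics n. f dvd h}" using monics_mult[OF f, of _ "n - m"] \<open>m \<le> n\<close> by auto
qed

lemma irreducible_degree_pos:
  fixes f :: "'b::{finite, field_gcd} poly"
  assumes "irreducible f" shows "degree f > 0"
proof (rule ccontr)
  assume "\<not> degree f > 0"
  moreover have "f \<noteq> 0" using assms by auto
  ultimately have "is_unit f" by (simp add: is_unit_iff_degree)
  with assms show False using irreducible_not_unit by blast
qed

lemma prime_factors_monic:
  fixes f :: "'b::{finite, field_gcd} poly"
  assumes "f \<in> monics n"
  shows "prime_factors f = {P. monic P \<and> irreducible P \<and> P dvd f}"
proof -
  have f0: "f \<noteq> 0" using monicsD[OF assms] by auto
  have "prime P \<longleftrightarrow> monic P \<and> irreducible P" for P :: "'b poly"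
  proof
    assume P: "prime P"
    hence "normalize P = P" "P \<noteq> 0" by auto
    thus "monic P \<and> irreducible P"
      using monic_normalize[of P] P by (auto intro: prime_elem_imp_irreducible)
  next
    assume "monic P \<and> irreducible P"
    thus "prime P"
      using irreducible_imp_prime_elem[of P] normalize_monic[of P]
      by (intro normalization_semidom_class.primeI) auto
  qed
  thus ?thesis using f0 by (auto simp: prime_factors_dvd)
qed

text \<open>The polynomial form of log n = sum of Lambda(d) over d | n. The multiplicity of P in f
  is the number of j >= 1 with P^j | f, so deg f is the sum of deg P over all prime powers P^j
  dividing f; these are then sorted by their degree k.\<close>

lemma degree_eq_sum_prime_power_divisors:
  fixes f :: "'b::{finite, field_gcd} poly"
  assumes f: "f \<in> monics n"
  shows "n = (\<Sum>k=1..n. \<Sum>e\<in>{e. e dvd k}. \<Sum>P\<in>{P \<in> prime_monics e. P ^ (k div e) dvd f}. e)"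
    (is "_ = (\<Sum>k=1..n. \<Sum>e\<in>{e. e dvd k}. \<Sum>P\<in>?A k e. e)")
proof -
  have f0: "f \<noteq> 0" and deg: "degree f = n" using monicsD[OF f] by auto
  have "(\<Prod>P\<in>prime_factors f. P ^ multiplicity P f) = f"
    using prod_prime_factors[OF f0] normalize_monic[OF monicsD(1)[OF f]] by simp
  hence "n = degree (\<Prod>P\<in>prime_factors f. P ^ multiplicity P f)" using deg by simp
  also have "\<dots> = (\<Sum>P\<in>prime_factors f. degree (P ^ multiplicity P f))"
    by (rule degree_prod_sum_eq) auto
  also have "\<dots> = (\<Sum>P\<in>prime_factors f. \<Sum>j\<in>{1..multiplicity P f}. degree P)"
    by (intro sum.cong refl) (subst degree_power_eq, auto)
  also have "\<dots> = (\<Sum>(P, j)\<in>(SIGMA P:prime_factors f. {1..multiplicity P f}). degree P)"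
    by (rule sum.Sigma) auto
  \<comment> \<open>The index k is the degree j * deg P of the prime power, so that j is recovered
    as k div e with e = deg P > 0.\<close>
  also have "\<dots> = (\<Sum>((k, e), P)\<in>(SIGMA x:(SIGMA k:{1..n}. {e. e dvd k}). ?A (fst x) (snd x)). e)"
  proof (rule sum.reindex_bij_witness[of _ "\<lambda>((k, e), P). (P, k div e)" "\<lambda>(P, j). ((j * degree P, degree P), P)"], goal_cases)
    case (1 a)
    then obtain P j where a: "a = (P, j)" and P: "monic P" "irreducible P" "P dvd f"
      by (auto simp: prime_factors_monic[OF f])
    thus ?case using irreducible_degree_pos[OF P(2)] by auto
  next
    case (2 a)
    then obtain P j where a: "a = (P, j)" and P: "monic P" "irreducible P" "P dvd f"
      and j: "1 \<le> j" "j \<le> multiplicity P f"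
      by (auto simp: prime_factors_monic[OF f])
    have dp: "degree P > 0" using irreducible_degree_pos[OF P(2)] .
    have dvd: "P ^ j dvd f" using j(2) by (meson multiplicity_dvd')
    hence "degree (P ^ j) \<le> n" using deg f0 by (metis dvd_imp_degree_le)
    thus ?case using a P j dp dvd by (auto simp: prime_monics_def monics_def degree_power_eq mult.commute)
  next
    case (3 b)
    then obtain k e P where b: "b = ((k, e), P)" by (metis surj_pair)
    with 3 show ?case using irreducible_degree_pos[of P] by (auto simp: prime_monics_def monics_def)
  next
    case (4 b)
    then obtain k e P where b: "b = ((k, e), P)" by (metis surj_pair)
    with 4 have k: "1 \<le> k" "k \<le> n" "e dvd k" and P: "monic P" "irreducible P" "degree P = e"
      and dvd: "P ^ (k div e) dvd f"
      by (auto simp: prime_monics_def monics_def)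
    have e: "e > 0" using k by (auto intro: Nat.gr0I)
    with k have q: "k div e \<ge> 1" by (auto simp: dvd_div_ge_1)
    have "P dvd P ^ (k div e)" using q by (intro dvd_power) auto
    hence "P dvd f" using dvd by (rule dvd_trans)
    moreover have "k div e \<le> multiplicity P f"
      using dvd f0 P by (subst power_dvd_iff_le_multiplicity[symmetric]) (auto simp: irreducible_def)
    ultimately show ?case using b P q by (auto simp: prime_factors_monic[OF f])
  next
    case (5 a) thus ?case by auto
  qed
  also have "\<dots> = (\<Sum>x\<in>(SIGMA k:{1..n}. {e. e dvd k}). \<Sum>P\<in>?A (fst x) (snd x). snd x)"
    by (subst sum.Sigma) (auto simp: case_prod_unfold intro!: finite_SigmaI finite_divisors_nat)
  also have "\<dots> = (\<Sum>k=1..n. \<Sum>e\<in>{e. e dvd k}. \<Sum>P\<in>?A k e. e)"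
    by (subst sum.Sigma) (auto simp: case_prod_unfold intro!: finite_divisors_nat)
  finally show ?thesis .
qed

text \<open>The coefficient of T^k in T L'/L, where L is the Euler product of the factors 1/(1 - l P
  T^(deg P)): the prime powers P^j of degree k, each weighted by deg P.\<close>

definition mangoldt_sum :: "('b::{finite, field_gcd} poly \<Rightarrow> 'r::comm_ring_1) \<Rightarrow> nat \<Rightarrow> 'r" where
  "mangoldt_sum l k = (\<Sum>e\<in>{e. e dvd k}. \<Sum>P\<in>prime_monics e. of_nat e * l P ^ (k div e))"

text \<open>
  The logarithmic derivative of the Euler product of \<open>\<Sum>f. l f * T ^ degree f\<close>,
  compared coefficientwise so that no division occurs.
\<close>

lemma mangoldt_recurrence:
  fixes l :: "'b::{finite, field_gcd} poly \<Rightarrow> 'r::comm_ring_1"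
  assumes l1: "l 1 = 1"
    and lmult: "\<And>f h. monic f \<Longrightarrow> monic h \<Longrightarrow> l (f * h) = l f * l h"
  shows "of_nat n * (\<Sum>f\<in>monics n. l f) = (\<Sum>k=1..n. mangoldt_sum l k * (\<Sum>f\<in>monics (n - k). l f))"
proof -
  have lpow: "l (f ^ j) = l f ^ j" if "monic f" for f j
    by (induction j) (use that in \<open>auto simp: l1 lmult monic_power\<close>)
  let ?E = "\<lambda>k. {e. e dvd k}"
  \<comment> \<open>The monic multiples of a monic polynomial of degree k are its products with the
    monics of degree n - k, and multiplicativity takes the prime power out of the sum.\<close>
  have inner: "(\<Sum>f\<in>monics n. if P ^ (k div e) dvd f then of_nat e * l f else 0) =
      of_nat e * l P ^ (k div e) * (\<Sum>f\<in>monics (n - k). l f)"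
    if k: "k \<in> {1..n}" and e: "e dvd k" and P: "P \<in> prime_monics e" for k e P
  proof -
    have Pm: "P \<in> monics e" using P by (simp add: prime_monics_def)
    have Pk: "P ^ (k div e) \<in> monics k" using monics_power[OF Pm, of "k div e"] e by simp
    have "(\<Sum>f\<in>monics n. if P ^ (k div e) dvd f then of_nat e * l f else 0) =
        (\<Sum>f\<in>{f \<in> monics n. P ^ (k div e) dvd f}. of_nat e * l f)"
      by (subst sum.inter_filter) auto
    also have "\<dots> = (\<Sum>f\<in>monics (n - k). of_nat e * l (P ^ (k div e) * f))"
    proof -
      have "P ^ (k div e) \<noteq> 0" using monicsD(1)[OF Pk] by (metis coeff_0 zero_neq_one)
      hence "inj_on ((*) (P ^ (k div e))) (monics (n - k))"
        by (intro inj_onI) (metis mult_left_cancel)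
      thus ?thesis using k by (subst monics_multiples[OF Pk]) (simp_all add: sum.reindex)
    qed
    also have "\<dots> = (\<Sum>f\<in>monics (n - k). of_nat e * l P ^ (k div e) * l f)"
      using monicsD(1)[OF Pk] monicsD(1)[OF Pm]
      by (intro sum.cong refl) (simp add: lmult[OF _ monicsD(1)] lpow mult.assoc)
    finally show ?thesis by (simp add: sum_distrib_left)
  qed
  have "of_nat n * (\<Sum>f\<in>monics n. l f) = (\<Sum>f\<in>monics n. of_nat n * l f)"
    by (simp add: sum_distrib_left)
  also have "\<dots> = (\<Sum>f\<in>monics n. \<Sum>k=1..n. \<Sum>e\<in>?E k. \<Sum>P\<in>prime_monics e.
      if P ^ (k div e) dvd f then of_nat e * l f else 0)"
  proof (rule sum.cong[OF refl])
    fix f :: "'b poly" assume f: "f \<in> monics n"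
    have "of_nat n = (\<Sum>k=1..n. \<Sum>e\<in>?E k. \<Sum>P\<in>{P \<in> prime_monics e. P ^ (k div e) dvd f}. of_nat e :: 'r)"
      by (subst degree_eq_sum_prime_power_divisors[OF f]) simp
    hence "of_nat n * l f = (\<Sum>k=1..n. \<Sum>e\<in>?E k. \<Sum>P\<in>{P \<in> prime_monics e. P ^ (k div e) dvd f}. of_nat e * l f)"
      by (simp only: sum_distrib_right)
    thus "of_nat n * l f = (\<Sum>k=1..n. \<Sum>e\<in>?E k. \<Sum>P\<in>prime_monics e.
      if P ^ (k div e) dvd f then of_nat e * l f else 0)"
      by (simp only: sum.inter_filter finite_prime_monics)
  qed
  also have "\<dots> = (\<Sum>k=1..n. \<Sum>f\<in>monics n. \<Sum>e\<in>?E k. \<Sum>P\<in>prime_monics e.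
      if P ^ (k div e) dvd f then of_nat e * l f else 0)"
    by (rule sum.swap)
  also have "\<dots> = (\<Sum>k=1..n. \<Sum>e\<in>?E k. \<Sum>f\<in>monics n. \<Sum>P\<in>prime_monics e.
      if P ^ (k div e) dvd f then of_nat e * l f else 0)"
    by (intro sum.cong refl sum.swap)
  also have "\<dots> = (\<Sum>k=1..n. \<Sum>e\<in>?E k. \<Sum>P\<in>prime_monics e. \<Sum>f\<in>monics n.
      if P ^ (k div e) dvd f then of_nat e * l f else 0)"
    by (intro sum.cong refl sum.swap)
  also have "\<dots> = (\<Sum>k=1..n. \<Sum>e\<in>?E k. \<Sum>P\<in>prime_monics e.
      of_nat e * l P ^ (k div e) * (\<Sum>f\<in>monics (n - k). l f))"
    by (intro sum.cong refl inner) auto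
  also have "\<dots> = (\<Sum>k=1..n. mangoldt_sum l k * (\<Sum>f\<in>monics (n - k). l f))"
    by (simp add: mangoldt_sum_def sum_distrib_right)
  finally show ?thesis .
qed

text \<open>For L = 1 + s T only the terms k = n and k = n - 1 of the recurrence survive, so each
  step multiplies by -s. These are the coefficients of T L'/L = s T/(1 + s T).\<close>

lemma mangoldt_sum_power:
  fixes l :: "'b::{finite, field_gcd} poly \<Rightarrow> 'r::comm_ring_1"
  assumes l1: "l 1 = 1"
    and lmult: "\<And>f h. monic f \<Longrightarrow> monic h \<Longrightarrow> l (f * h) = l f * l h"
    and vanish: "\<And>n. n \<ge> 2 \<Longrightarrow> (\<Sum>f\<in>monics n. l f) = 0"
    and "n \<ge> 1"
  shows "mangoldt_sum l n = (- 1) ^ (n - 1) * (\<Sum>f\<in>monics 1. l f) ^ n"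
  using \<open>n \<ge> 1\<close>
proof (induction n rule: nat_induct_at_least)
  case base
  have "of_nat 1 * (\<Sum>f\<in>monics 1. l f) = (\<Sum>k=1..1. mangoldt_sum l k * (\<Sum>f\<in>monics (1 - k). l f))"
    by (rule mangoldt_recurrence[OF l1 lmult])
  also have "\<dots> = mangoldt_sum l 1" by (simp add: monics_0 l1)
  finally show ?case by simp
next
  case (Suc n)
  let ?L = "\<lambda>n. \<Sum>f\<in>monics n. l f"
  have "0 = of_nat (Suc n) * ?L (Suc n)" using vanish[of "Suc n"] Suc.hyps by simp
  also have "\<dots> = (\<Sum>k=1..Suc n. mangoldt_sum l k * ?L (Suc n - k))"
    by (rule mangoldt_recurrence[OF l1 lmult])
  also have "\<dots> = (\<Sum>k\<in>{n, Suc n}. mangoldt_sum l k * ?L (Suc n - k))"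
  proof (rule sum.mono_neutral_right)
    show "\<forall>k\<in>{1..Suc n} - {n, Suc n}. mangoldt_sum l k * ?L (Suc n - k) = 0"
    proof
      fix k assume "k \<in> {1..Suc n} - {n, Suc n}"
      hence "?L (Suc n - k) = 0" by (intro vanish) auto
      thus "mangoldt_sum l k * ?L (Suc n - k) = 0" by simp
    qed
  qed (use Suc.hyps in auto)
  also have "\<dots> = mangoldt_sum l n * ?L 1 + mangoldt_sum l (Suc n)"
    by (simp add: monics_0 l1)
  finally have "mangoldt_sum l (Suc n) = - (mangoldt_sum l n * ?L 1)"
    by (simp add: eq_neg_iff_add_eq_0 add.commute)
  also have "\<dots> = (- 1) ^ (Suc n - 1) * ?L 1 ^ Suc n"
    using Suc.IH Suc.hyps by (cases n) (auto simp: algebra_simps)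
  finally show ?case .
qed

section \<open>Convolution powers of a cubic character\<close>

text \<open>Multiplication of finitely supported functions is convolution over the additive group of
  \<open>'b\<close>, so this type is the group ring, and \<open>group_sum f\<close> is the formal
  sum with coefficients f.\<close>

definition group_sum :: "('b::{finite, field_gcd} \<Rightarrow> 'r::comm_ring_1) \<Rightarrow> ('b \<Rightarrow>\<^sub>0 'r)" where
  "group_sum f = (\<Sum>u\<in>UNIV. Poly_Mapping.single u (f u))"

lemma lookup_group_sum [simp]: "Poly_Mapping.lookup (group_sum f) c = f c"
proof -
  have "Poly_Mapping.lookup (group_sum f) c = (\<Sum>u\<in>UNIV. if u = c then f u else 0)"
    unfolding group_sum_def lookup_sum by (intro sum.cong refl) (simp add: lookup_single when_def)
  thus ?thesis by simp
qed

lemma group_sum_eq_iff: "group_sum f = group_sum h \<longleftrightarrow> f = h"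
  by (metis ext lookup_group_sum)

lemma single_sum: "Poly_Mapping.single c (sum f A) = (\<Sum>u\<in>A. Poly_Mapping.single c (f u))"
  by (induction A rule: infinite_finite_induct) (auto simp: single_add)

lemma group_sum_mult: "group_sum f * group_sum h = group_sum (\<lambda>c. \<Sum>u\<in>UNIV. f u * h (c - u))"
proof -
  have "group_sum f * group_sum h = (\<Sum>u\<in>UNIV. \<Sum>v\<in>UNIV. Poly_Mapping.single (u + v) (f u * h v))"
    by (simp add: group_sum_def sum_product mult_single)
  also have "\<dots> = (\<Sum>u\<in>UNIV. \<Sum>c\<in>UNIV. Poly_Mapping.single c (f u * h (c - u)))"
  proof (rule sum.cong[OF refl])
    fix u
    show "(\<Sum>v\<in>UNIV. Poly_Mapping.single (u + v) (f u * h v)) =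
        (\<Sum>c\<in>UNIV. Poly_Mapping.single c (f u * h (c - u)))"
      by (rule sum.reindex_bij_witness[of _ "\<lambda>c. c - u" "\<lambda>v. u + v"]) auto
  qed
  also have "\<dots> = (\<Sum>c\<in>UNIV. \<Sum>u\<in>UNIV. Poly_Mapping.single c (f u * h (c - u)))"
    by (rule sum.swap)
  also have "\<dots> = group_sum (\<lambda>c. \<Sum>u\<in>UNIV. f u * h (c - u))"
    by (simp add: group_sum_def single_sum)
  finally show ?thesis .
qed

locale cubic_character =
  fixes \<chi> :: "'b::{finite, field_gcd} \<Rightarrow> complex"
  assumes chi_0 [simp]: "\<chi> 0 = 0" and chi_1 [simp]: "\<chi> 1 = 1"
    and chi_mult [simp]: "\<chi> (x * y) = \<chi> x * \<chi> y"
    and chi_cube: "x \<noteq> 0 \<Longrightarrow> \<chi> x ^ 3 = 1"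
    and chi_nontrivial: "\<exists>x. x \<noteq> 0 \<and> \<chi> x \<noteq> 1"
begin

lemma chi_nonzero: "x \<noteq> 0 \<Longrightarrow> \<chi> x \<noteq> 0"
  using chi_cube[of x] by auto

lemma chi_power: "\<chi> (x ^ n) = \<chi> x ^ n"
  by (induction n) auto

text \<open>\<open>\<chi> (-1)\<close> is at once a square root and a cube root of 1.\<close>

lemma chi_minus [simp]: "\<chi> (- x) = \<chi> x"
proof -
  have "\<chi> (-1) ^ 2 = 1" using chi_mult[of "-1" "-1"] by (simp add: power2_eq_square)
  moreover have "\<chi> (-1) ^ 3 = 1" by (rule chi_cube) simp
  ultimately have "\<chi> (-1) = 1" by (simp add: power3_eq_cube power2_eq_square)
  thus ?thesis using chi_mult[of "-1" x] by simp
qed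

lemma chi_cube': "x \<noteq> 0 \<Longrightarrow> \<chi> x * \<chi> x ^ 2 = 1"
  using chi_cube[of x] by (simp add: power3_eq_cube power2_eq_square mult.assoc)

lemma norm_chi: "x \<noteq> 0 \<Longrightarrow> norm (\<chi> x) = 1"
proof -
  assume "x \<noteq> 0"
  hence "norm (\<chi> x) ^ 3 = 1" using chi_cube[of x] by (simp flip: norm_power)
  thus ?thesis using power_eq_1_iff[of "norm (\<chi> x)" 3] by simp
qed

lemma cnj_chi: "cnj (\<chi> x) = \<chi> x ^ 2"
proof (cases "x = 0")
  case False
  have "\<chi> x * cnj (\<chi> x) = 1"
    using norm_chi[OF False] by (simp add: complex_norm_square[symmetric])
  also have "\<dots> = \<chi> x * \<chi> x ^ 2"
    using chi_cube'[OF False] by simp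
  finally show ?thesis using chi_nonzero[OF False] by simp
qed simp

lemma chi_inverse: "\<chi> (inverse x) = \<chi> x ^ 2"
proof (cases "x = 0")
  case False
  have "\<chi> x * \<chi> (inverse x) = \<chi> x * \<chi> x ^ 2"
    using False chi_mult[of x "inverse x"] chi_cube'[OF False] by simp
  thus ?thesis using chi_nonzero[OF False] by simp
qed simp

lemma sum_chi: "(\<Sum>x\<in>UNIV. \<chi> x) = 0"
proof -
  obtain y where y: "y \<noteq> 0" "\<chi> y \<noteq> 1" using chi_nontrivial by blast
  have "(\<Sum>x\<in>UNIV. \<chi> x) = (\<Sum>x\<in>UNIV. \<chi> (y * x))"
    by (rule sum.reindex_bij_witness[of _ "\<lambda>x. y * x" "\<lambda>x. x / y"]) (use y in auto)
  also have "\<dots> = \<chi> y * (\<Sum>x\<in>UNIV. \<chi> x)" by (simp add: sum_distrib_left)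
  finally have "(\<chi> y - 1) * (\<Sum>x\<in>UNIV. \<chi> x) = 0" by (simp add: algebra_simps)
  thus ?thesis using y by simp
qed

lemma sum_chi_sq: "(\<Sum>x\<in>UNIV. \<chi> x ^ 2) = 0"
  using arg_cong[OF sum_chi, of cnj] by (simp add: cnj_chi)

definition jacobi :: complex where
  "jacobi = (\<Sum>u\<in>UNIV. \<chi> u * \<chi> (1 - u))"

abbreviation gauss :: "'b \<Rightarrow>\<^sub>0 complex" where "gauss \<equiv> group_sum \<chi>"

text \<open>For c nonzero the substitution of c u for u pulls out \<open>\<chi> c ^ 2\<close>. At c
  = 0 the sum is that of \<open>\<chi> u ^ 2\<close>, hence 0, in agreement with
  \<open>\<chi> 0 = 0\<close>.\<close>

lemma conv_chi_chi: "(\<Sum>u\<in>UNIV. \<chi> u * \<chi> (c - u)) = jacobi * \<chi> c ^ 2"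
proof (cases "c = 0")
  case True
  thus ?thesis using sum_chi_sq by (simp add: power2_eq_square)
next
  case False
  have "(\<Sum>u\<in>UNIV. \<chi> u * \<chi> (c - u)) = (\<Sum>u\<in>UNIV. \<chi> (c * u) * \<chi> (c - c * u))"
    by (rule sum.reindex_bij_witness[of _ "\<lambda>x. c * x" "\<lambda>x. x / c"]) (use False in auto)
  also have "\<dots> = (\<Sum>u\<in>UNIV. \<chi> c ^ 2 * (\<chi> u * \<chi> (1 - u)))"
  proof (rule sum.cong[OF refl])
    fix u
    have "c - c * u = c * (1 - u)" by (simp add: algebra_simps)
    thus "\<chi> (c * u) * \<chi> (c - c * u) = \<chi> c ^ 2 * (\<chi> u * \<chi> (1 - u))"
      by (simp only: chi_mult) (simp add: power2_eq_square)
  qed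
  also have "\<dots> = jacobi * \<chi> c ^ 2"
    by (simp only: jacobi_def sum_distrib_left mult.commute)
  finally show ?thesis .
qed

text \<open>Since \<open>\<chi>\<close> squared inverts \<open>\<chi>\<close>, the summand is
  \<open>\<chi> (u / (c - u))\<close>. For c nonzero, u / (c - u) runs through everything except -1
  as u avoids c, so only \<open>\<chi> (- 1) = 1\<close> is missing from a vanishing sum.\<close>

lemma conv_chi_chi_sq:
  "(\<Sum>u\<in>UNIV. \<chi> u * \<chi> (c - u) ^ 2) = (if c = 0 then of_nat CARD('b) - 1 else - 1)"
proof (cases "c = 0")
  case True
  have "(\<Sum>u\<in>UNIV. \<chi> u * \<chi> (c - u) ^ 2) = (\<Sum>u\<in>(UNIV :: 'b set). if u = 0 then 0 else 1)"
    by (rule sum.cong) (simp_all add: True chi_cube')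
  also have "\<dots> = of_nat (card (UNIV - {0 :: 'b}))"
    by (simp add: sum.If_cases Compl_eq_Diff_UNIV)
  finally show ?thesis using True finite_UNIV_card_ge_0[where 'a = 'b] by (simp add: card_Diff_singleton of_nat_diff Suc_leI)
next
  case False
  have "(\<Sum>u\<in>UNIV. \<chi> u * \<chi> (c - u) ^ 2) = (\<Sum>u\<in>UNIV - {c}. \<chi> (u / (c - u)))"
    by (rule sum.mono_neutral_cong_right) (auto simp: divide_inverse chi_inverse)
  also have "\<dots> = (\<Sum>w\<in>UNIV - {- 1}. \<chi> w)"
  proof -
    have "c + w * c = (1 + w) * c" for w by (simp add: algebra_simps)
    hence "c + w * c = 0 \<longleftrightarrow> w + 1 = 0" for w using False by (simp add: add.commute)
    thus ?thesis
      by (intro sum.reindex_bij_witness[of _ "\<lambda>w. c * w / (1 + w)" "\<lambda>u. u / (c - u)"])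
         (use False in \<open>auto simp: divide_simps algebra_simps eq_neg_iff_add_eq_0\<close>)
  qed
  also have "\<dots> = (\<Sum>w\<in>UNIV. \<chi> w) - \<chi> (- 1)"
    by (subst sum_diff1) auto
  finally show ?thesis using False by (simp add: sum_chi)
qed

lemma gauss_sq: "gauss ^ 2 = group_sum (\<lambda>c. jacobi * \<chi> c ^ 2)"
  by (simp add: power2_eq_square group_sum_mult conv_chi_chi)

lemma gauss_cube: "gauss ^ 3 = group_sum (\<lambda>c. jacobi * (if c = 0 then of_nat CARD('b) - 1 else - 1))"
proof -
  have "gauss ^ 3 = gauss * gauss ^ 2" by (simp add: power3_eq_cube power2_eq_square)
  also have "\<dots> = group_sum (\<lambda>c. jacobi * (\<Sum>u\<in>UNIV. \<chi> u * \<chi> (c - u) ^ 2))"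
    by (simp add: gauss_sq group_sum_mult sum_distrib_left mult_ac)
  finally show ?thesis by (simp add: conv_chi_chi_sq)
qed

text \<open>The second factor is CARD times the delta at 0 minus the constant 1, and convolution
  with a constant kills \<open>\<chi>\<close> because its values sum to 0.\<close>

lemma conv_chi_delta:
  "(\<Sum>u\<in>UNIV. \<chi> u * (if c - u = 0 then of_nat CARD('b) - 1 else - 1)) = of_nat CARD('b) * \<chi> c"
proof -
  have "(\<Sum>u\<in>UNIV. \<chi> u * (if c - u = 0 then of_nat CARD('b) - 1 else - 1)) =
      (\<Sum>u\<in>UNIV. (if u = c then of_nat CARD('b) * \<chi> u else 0) - \<chi> u)"
    by (intro sum.cong refl) (auto simp: algebra_simps)
  thus ?thesis by (simp add: sum_subtractf sum_chi)
qed

definition group_scalar :: "complex \<Rightarrow> ('b \<Rightarrow>\<^sub>0 complex)" where "group_scalar z = Poly_Mapping.single 0 z"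

lemma group_scalar_mult: "group_scalar z * group_sum f = group_sum (\<lambda>c. z * f c)"
  by (simp add: group_scalar_def group_sum_def sum_distrib_left mult_single)

lemma gauss_power_4: "gauss ^ 4 = group_scalar (of_nat CARD('b) * jacobi) * gauss"
proof -
  have "gauss ^ 4 = gauss * gauss ^ 3" by (simp add: power4_eq_xxxx power3_eq_cube)
  also have "\<dots> = group_sum (\<lambda>c. jacobi * (\<Sum>u\<in>UNIV. \<chi> u * (if c - u = 0 then of_nat CARD('b) - 1 else - 1)))"
    by (simp add: gauss_cube group_sum_mult sum_distrib_left mult.left_commute)
  also have "\<dots> = group_scalar (of_nat CARD('b) * jacobi) * gauss"
    by (simp only: conv_chi_delta group_scalar_mult mult.assoc mult.left_commute)
  finally show ?thesis .
qed

text \<open>The condition on n leaves a factor \<open>gauss\<close> next to every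
  \<open>gauss ^ 3\<close>; only then may the latter be replaced by a scalar.\<close>

lemma gauss_power_shift:
  assumes "n \<ge> 1"
  shows "gauss ^ (3 * k + n) = group_scalar ((of_nat CARD('b) * jacobi) ^ k) * gauss ^ n"
proof (induction k)
  case 0
  show ?case by (simp add: group_scalar_def single_one)
next
  case (Suc k)
  obtain n' where n: "n = Suc n'" using assms by (cases n) auto
  have "gauss ^ (3 * Suc k + n) = gauss ^ (3 * k + n) * gauss ^ 3"
  proof -
    have "3 * Suc k + n = (3 * k + n) + 3" by simp
    thus ?thesis by (simp only: power_add)
  qed
  also have "\<dots> = group_scalar ((of_nat CARD('b) * jacobi) ^ k) * (gauss ^ n' * gauss ^ 4)"
    unfolding Suc.IH by (simp add: n power_add[symmetric] mult.assoc numeral_eq_Suc)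
  also have "\<dots> = group_scalar ((of_nat CARD('b) * jacobi) ^ k) * group_scalar (of_nat CARD('b) * jacobi) * gauss ^ n"
    by (simp add: gauss_power_4 n mult_ac)
  also have "group_scalar ((of_nat CARD('b) * jacobi) ^ k) * group_scalar (of_nat CARD('b) * jacobi) = group_scalar ((of_nat CARD('b) * jacobi) ^ Suc k)"
    by (simp add: group_scalar_def mult_single mult_ac)
  finally show ?case .
qed

lemma lookup_gauss_power:
  assumes "n \<ge> 1"
  shows "Poly_Mapping.lookup (gauss ^ n) c =
    (if n mod 3 = 1 then (of_nat CARD('b) * jacobi) ^ ((n - 1) div 3) * \<chi> c
     else if n mod 3 = 2 then (of_nat CARD('b) * jacobi) ^ ((n - 2) div 3) * jacobi * \<chi> c ^ 2
     else (of_nat CARD('b) * jacobi) ^ ((n - 3) div 3) * jacobi * (if c = 0 then of_nat CARD('b) - 1 else - 1))"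
proof -
  consider "n mod 3 = 1" | "n mod 3 = 2" | "n mod 3 = 0" by linarith
  thus ?thesis
  proof cases
    case 1
    then obtain k where "n = 3 * k + 1" by (metis mult_div_mod_eq)
    thus ?thesis using gauss_power_shift[of 1 k] by (simp add: group_scalar_mult)
  next
    case 2
    then obtain k where n: "n = 3 * k + 2" by (metis mult_div_mod_eq)
    hence k: "(n - 2) div 3 = k" by simp
    have "gauss ^ n = group_sum (\<lambda>c. (of_nat CARD('b) * jacobi) ^ k * (jacobi * \<chi> c ^ 2))"
      using gauss_power_shift[of 2 k] by (simp only: n gauss_sq group_scalar_mult one_le_numeral)
    thus ?thesis using 2 k by simp
  next
    \<comment> \<open>The representative of the residue 0 is the exponent 3, not 0, as the shift
      wants a positive exponent.\<close>
    case 3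
    with assms obtain k where "n = 3 * k + 3"
      by (metis add.commute mod_0_imp_dvd dvdE mult_Suc_right not_one_le_zero mult_0_right not0_implies_Suc)
    thus ?thesis using gauss_power_shift[of 3 k] by (simp add: gauss_cube group_scalar_mult)
  qed
qed

text \<open>Associativity of the convolution product evaluates \<open>\<chi>\<^sup>2 * \<chi> * \<chi>\<close> in two ways.\<close>

lemma norm_jacobi: "jacobi * cnj jacobi = of_nat CARD('b)"
proof -
  have conj: "(\<Sum>u\<in>UNIV. \<chi> u ^ 2 * \<chi> (c - u) ^ 2) = cnj jacobi * \<chi> c" for c
  proof -
    have "cnj (\<chi> c ^ 2) = \<chi> c"
      by (metis cnj_chi complex_cnj_cnj)
    thus ?thesis using arg_cong[OF conv_chi_chi[of c], of cnj] by (simp add: cnj_chi)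
  qed
  let ?G = "group_sum (\<lambda>c. \<chi> c ^ 2)"
  have "gauss * (gauss * ?G) = group_sum (\<lambda>c. \<Sum>u\<in>UNIV. \<chi> u * (if c - u = 0 then of_nat CARD('b) - 1 else - 1))"
    by (simp add: group_sum_mult conv_chi_chi_sq)
  also have "\<dots> = group_sum (\<lambda>c. of_nat CARD('b) * \<chi> c)" by (simp only: conv_chi_delta)
  finally have "group_sum (\<lambda>c. of_nat CARD('b) * \<chi> c) = gauss ^ 2 * ?G"
    by (simp add: power2_eq_square mult.assoc)
  also have "\<dots> = group_sum (\<lambda>c. jacobi * (\<Sum>u\<in>UNIV. \<chi> u ^ 2 * \<chi> (c - u) ^ 2))"
    by (simp add: gauss_sq group_sum_mult sum_distrib_left mult_ac)
  also have "\<dots> = group_sum (\<lambda>c. jacobi * (cnj jacobi * \<chi> c))" by (simp only: conj)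
  finally have "(\<lambda>c. of_nat CARD('b) * \<chi> c) = (\<lambda>c. jacobi * (cnj jacobi * \<chi> c))"
    by (simp add: group_sum_eq_iff)
  from fun_cong[OF this, of 1] show ?thesis by simp
qed

end

section \<open>The Hasse-Davenport relation\<close>

text \<open>For monic f this is the sum of the roots, minus the coefficient next to the leading one.
  Read from the reflected polynomial it needs no separate degree 0, and additivity is the product
  rule for the coefficient of X.\<close>

definition poly_trace :: "'b::idom poly \<Rightarrow> 'b" where
  "poly_trace f = - coeff (reflect_poly f) 1"

lemma poly_trace_mult:
  "monic f \<Longrightarrow> monic h \<Longrightarrow> poly_trace (f * h) = poly_trace f + poly_trace h"
  by (simp add: poly_trace_def reflect_poly_mult coeff_mult)

lemma poly_trace_1 [simp]: "poly_trace 1 = 0"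
  by (simp add: poly_trace_def)

lemma poly_trace_linear: "poly_trace [:- u, 1:] = u"
  by (simp add: poly_trace_def coeff_reflect_poly)

lemma poly_trace_prod_linear: "poly_trace (\<Prod>i\<in>A. [:- s i, 1:]) = (\<Sum>i\<in>A. s i)"
proof (induction A rule: infinite_finite_induct)
  case (insert i A)
  have "monic (\<Prod>i\<in>A. [:- s i, 1:])" by (rule monic_prod) auto
  hence "poly_trace ([:- s i, 1:] * (\<Prod>i\<in>A. [:- s i, 1:])) = s i + (\<Sum>i\<in>A. s i)"
    using insert by (subst poly_trace_mult) (simp_all only: poly_trace_linear, simp)
  thus ?case using insert by (simp only: prod.insert sum.insert not_False_eq_True)
qed auto

lemma coeff_0_prod_linear: "coeff (\<Prod>i\<in>A. [:- s i, 1:]) 0 = (- 1) ^ card A * (\<Prod>i\<in>A. s i :: 'b::idom)"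
  by (induction A rule: infinite_finite_induct) (auto simp: coeff_mult)

lemma (in inj_idom_hom) poly_trace_map_poly: "poly_trace (map_poly hom f) = hom (poly_trace f)"
  by (simp add: poly_trace_def coeff_reflect_poly hom_distribs)

context cubic_character
begin

text \<open>The product of the roots of \<open>f\<close> is \<open>coeff f 0\<close> up to a sign, which \<open>\<chi>\<close> does not see.\<close>

definition monic_weight :: "'b poly \<Rightarrow> ('b \<Rightarrow>\<^sub>0 complex)" where
  "monic_weight f = Poly_Mapping.single (poly_trace f) (\<chi> (coeff f 0))"

lemma monic_weight_1: "monic_weight 1 = 1"
  by (simp add: monic_weight_def single_one)

lemma monic_weight_mult: "monic f \<Longrightarrow> monic h \<Longrightarrow> monic_weight (f * h) = monic_weight f * monic_weight h"
  by (simp add: monic_weight_def poly_trace_mult coeff_mult mult_single)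

lemma sum_monic_weight_monics_1: "(\<Sum>f\<in>monics 1. monic_weight f) = gauss"
proof -
  have "inj (\<lambda>u :: 'b. [:- u, 1:])" by (auto intro!: injI)
  moreover have "monic_weight [:- u, 1:] = Poly_Mapping.single u (\<chi> u)" for u
    unfolding monic_weight_def poly_trace_linear by simp
  ultimately show ?thesis unfolding monics_1 by (simp only: sum.reindex o_def group_sum_def)
qed

text \<open>Rescaling the constant coefficient leaves the trace alone as soon as the degree is at least 2.\<close>

lemma sum_monic_weight_monics_eq_0:
  assumes "n \<ge> 2"
  shows "(\<Sum>f\<in>monics n. monic_weight f) = 0"
proof -
  obtain y where y: "y \<noteq> 0" "\<chi> y \<noteq> 1" using chi_nontrivial by blast
  define sh where "sh = (\<lambda>y (f :: 'b poly). f + [:(y - 1) * coeff f 0:])"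
  have coeff_sh: "coeff (sh y f) k = (if k = 0 then y * coeff f 0 else coeff f k)" for y f k
    by (cases k) (auto simp: sh_def algebra_simps)
  have sh: "sh y f \<in> monics n" "poly_trace (sh y f) = poly_trace f" if "f \<in> monics n" for y f
  proof -
    have "degree [:(y - 1) * coeff f 0:] < degree f" using that assms by (simp add: monics_def)
    hence deg: "degree (sh y f) = n" using that by (simp add: sh_def monics_def degree_add_eq_left)
    show "sh y f \<in> monics n" using that assms deg by (auto simp: monics_def coeff_sh)
    show "poly_trace (sh y f) = poly_trace f"
      using that assms deg by (simp add: monics_def poly_trace_def coeff_reflect_poly coeff_sh)
  qed
  have inv: "sh y (sh z f) = f" if "y * z = 1" for y z f
    using that by (intro poly_eqI) (simp add: coeff_sh flip: mult.assoc)
  have "(\<Sum>f\<in>monics n. monic_weight f) = (\<Sum>f\<in>monics n. monic_weight (sh y f))"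
    by (rule sum.reindex_bij_witness[of _ "sh y" "sh (inverse y)"]) (use y in \<open>auto simp: sh inv\<close>)
  also have "\<dots> = (\<Sum>f\<in>monics n. group_scalar (\<chi> y) * monic_weight f)"
    by (intro sum.cong refl) (simp add: monic_weight_def sh group_scalar_def mult_single coeff_sh)
  finally have eq: "(\<Sum>f\<in>monics n. monic_weight f) = group_scalar (\<chi> y) * (\<Sum>f\<in>monics n. monic_weight f)"
    unfolding sum_distrib_left .
  \<comment> \<open>The group ring has zero divisors, so the scalar \<open>\<chi> y\<close>,
    different from 1, is cancelled coefficient by coefficient.\<close>
  define h where "h = Poly_Mapping.lookup (\<Sum>f\<in>monics n. monic_weight f)"
  have h: "(\<Sum>f\<in>monics n. monic_weight f) = group_sum h"
    by (rule poly_mapping_eqI) (simp add: h_def)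
  from eq have "h = (\<lambda>c. \<chi> y * h c)" unfolding h group_scalar_mult group_sum_eq_iff .
  hence "h = (\<lambda>_. 0)" using y by (metis mult_cancel_right1)
  thus ?thesis unfolding h by (simp add: group_sum_def)
qed

theorem hasse_davenport:
  "n \<ge> 1 \<Longrightarrow> mangoldt_sum monic_weight n = (- 1) ^ (n - 1) * gauss ^ n"
  using mangoldt_sum_power[of monic_weight n] monic_weight_1 monic_weight_mult sum_monic_weight_monics_eq_0 sum_monic_weight_monics_1 by simp

lemma lookup_mangoldt_sum:
  assumes "n \<ge> 1"
  shows "Poly_Mapping.lookup (mangoldt_sum monic_weight n) c = (- 1) ^ (n - 1) * Poly_Mapping.lookup (gauss ^ n) c"
proof -
  define h where "h = Poly_Mapping.lookup (gauss ^ n)"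
  have h: "gauss ^ n = group_sum h" by (rule poly_mapping_eqI) (simp add: h_def)
  have "(- 1) ^ k = group_scalar ((- 1) ^ k)" for k
    by (induction k) (auto simp: group_scalar_def single_one single_uminus mult_single)
  thus ?thesis using assms by (simp add: hasse_davenport h group_scalar_mult)
qed

end

section \<open>Roots of irreducible polynomials in an extension of the prime field\<close>

lemma degree_Xpow_minus_X:
  assumes "n \<ge> 2"
  shows "degree (monom 1 n - monom 1 1 :: 'b::idom poly) = n" "monic (monom 1 n - monom 1 1 :: 'b poly)"
proof -
  have "degree (monom 1 1 :: 'b poly) < degree (monom 1 n :: 'b poly)"
    using assms by (simp add: degree_monom_eq)
  thus d: "degree (monom 1 n - monom 1 1 :: 'b poly) = n"
    unfolding diff_conv_add_uminus by (subst degree_add_eq_left) (auto simp: degree_monom_eq)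
  show "monic (monom 1 n - monom 1 1 :: 'b poly)" unfolding d using assms by simp
qed

text \<open>The prime field is a type of its own, so that its polynomials have unique factorisation;
  they are evaluated in the extension through \<open>\<iota>\<close>.\<close>

locale prime_field_embedding = field_hom \<iota>
  for \<iota> :: "'c::prime_card mod_ring \<Rightarrow> 'a::finite_field" +
  fixes q :: nat
  assumes q_eq: "q = CARD('c)"
begin

sublocale inj_idom_hom \<iota> ..
interpretation mp: map_poly_inj_idom_hom \<iota> ..

abbreviation ev :: "'c mod_ring poly \<Rightarrow> 'a \<Rightarrow> 'a" where "ev f x \<equiv> poly (map_poly \<iota> f) x"

lemma CHAR_eq: "CHAR('a) = q"
proof -
  have "of_nat q = \<iota> (of_nat q)" by (simp add: hom_distribs)
  also have "\<dots> = 0" by (simp add: q_eq)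
  finally have "CHAR('a) dvd q" by (simp add: of_nat_eq_0_iff_char_dvd)
  moreover have "prime q" unfolding q_eq by (rule prime_card)
  moreover have "CHAR('a) \<noteq> 1" by simp
  ultimately show ?thesis by (metis prime_nat_iff)
qed

lemma q_ge_2: "q \<ge> 2"
  unfolding q_eq using prime_card prime_ge_2_nat by blast

lemma power_q_add: "(x + y :: 'a) ^ q = x ^ q + y ^ q"
  using freshmans_dream[where x = x and y = y and n = q] by (simp add: CHAR_eq q_eq prime_card)

lemma iota_power_q: "\<iota> x ^ q = \<iota> x"
  unfolding q_eq using finite_field_power_card_eq_same[of x] by (metis CARD_mod_ring hom_power)

text \<open>Frobenius is additive and multiplicative and fixes the coefficients; hence it permutes
  the roots of f.\<close>

lemma ev_power_q: "ev f (x ^ q) = ev f x ^ q"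
proof (induction f)
  case 0
  show ?case using q_ge_2 by (simp add: power_0_left)
next
  case (pCons a f)
  thus ?case by (simp add: hom_distribs power_q_add power_mult_distrib iota_power_q)
qed

lemma ev_power_q_power: "ev f (x ^ (q ^ j)) = ev f x ^ (q ^ j)"
proof (induction j)
  case (Suc j)
  have "x ^ (q ^ Suc j) = (x ^ (q ^ j)) ^ q" by (simp add: power_mult[symmetric] mult.commute)
  thus ?case using Suc by (simp add: ev_power_q power_mult mult.commute[of q])
qed simp

definition iota_inv :: "'a \<Rightarrow> 'c mod_ring" where "iota_inv = inv_into UNIV \<iota>"

lemma iota_inv [simp]: "iota_inv (\<iota> y) = y"
  by (simp add: iota_inv_def inj_f)

text \<open>Otherwise P and f are coprime, and a Bezout identity evaluated at the common root reads
  0 = 1.\<close>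

lemma irreducible_dvd_of_root:
  assumes P: "irreducible P" "ev P x = 0" and f: "ev f x = 0"
  shows "P dvd f"
proof (rule ccontr)
  assume "\<not> P dvd f"
  hence "gcd P f = 1"
    using prime_elem_imp_coprime[OF irreducible_imp_prime_elem[OF P(1)]] coprime_imp_gcd_eq_1 by auto
  then obtain a b where "a * P + b * f = 1"
    using bezout_coefficients_fst_snd[of P f] by metis
  hence "ev (a * P + b * f) x = ev 1 x" by simp
  thus False using P f by (simp add: hom_distribs)
qed

lemma ev_Xpow: "ev (monom 1 n - monom 1 1) x = x ^ n - x"
  by (simp add: hom_distribs poly_monom)

lemma prime_monic_dvd_Xpow:
  "P \<in> prime_monics e \<Longrightarrow> P dvd monom 1 (q ^ e) - monom 1 1" for P :: "'c mod_ring poly"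
  using degree_divisor(1)[of P e] by (simp add: prime_monics_def monics_def monom_power q_eq)

lemma prime_monic_root_fixed:
  assumes P: "P \<in> prime_monics e" "ev P x = 0"
  shows "x ^ (q ^ e) = x"
proof -
  obtain r where "monom 1 (q ^ e) - monom 1 1 = P * r"
    using prime_monic_dvd_Xpow[OF P(1)] by (elim dvdE)
  hence "ev (monom 1 (q ^ e) - monom 1 1) x = 0" using P by (simp add: hom_distribs)
  thus ?thesis unfolding ev_Xpow by simp
qed

lemma prime_monic_root_not_fixed:
  assumes P: "P \<in> prime_monics e" "ev P x = 0" and c: "1 \<le> c" "c < e"
  shows "x ^ (q ^ c) \<noteq> x"
proof
  assume "x ^ (q ^ c) = x"
  hence "ev (monom 1 (q ^ c) - monom 1 1) x = 0" unfolding ev_Xpow by simp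
  hence "P dvd monom 1 (q ^ c) - monom 1 1"
    using irreducible_dvd_of_root[of P x] P by (simp add: prime_monics_def)
  thus False using degree_divisor(2)[of P e c] P c
    by (simp add: prime_monics_def monics_def monom_power q_eq)
qed

lemma power_q_periodic:
  assumes "x ^ (q ^ e) = (x :: 'a)"
  shows "x ^ (q ^ (i + e * k)) = x ^ (q ^ i)"
proof (induction k)
  case (Suc k)
  have "x ^ (q ^ (i + e * Suc k)) = (x ^ (q ^ e)) ^ (q ^ (i + e * k))"
    by (simp add: power_mult[symmetric] power_add[symmetric] algebra_simps)
  thus ?case using Suc assms by simp
qed simp

text \<open>The Frobenius orbit of a root of P has length exactly deg P, so t may be reduced modulo
  e.\<close>

lemma prime_monic_root_fixed_iff:
  assumes P: "P \<in> prime_monics e" "ev P x = 0"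
  shows "x ^ (q ^ t) = x \<longleftrightarrow> e dvd t"
proof
  assume t: "x ^ (q ^ t) = x"
  have "e > 0" using P irreducible_degree_pos[of P] by (auto simp: prime_monics_def monics_def)
  have "x ^ (q ^ t) = x ^ (q ^ (t mod e))"
    using power_q_periodic[OF prime_monic_root_fixed[OF P], of "t mod e" "t div e"]
    by (simp add: mult.commute)
  hence "x ^ (q ^ (t mod e)) = x" using t by simp
  hence "\<not> 1 \<le> t mod e" using prime_monic_root_not_fixed[OF P, of "t mod e"] \<open>e > 0\<close> by auto
  thus "e dvd t" by (simp add: mod_eq_0_iff_dvd not_less_eq_eq)
next
  assume "e dvd t"
  then obtain k where "t = e * k" by (elim dvdE)
  thus "x ^ (q ^ t) = x" using power_q_periodic[OF prime_monic_root_fixed[OF P], of 0 k] by simp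
qed

lemma prime_monic_conjugates_inj:
  assumes P: "P \<in> prime_monics e" "ev P x = 0"
  shows "inj_on (\<lambda>j. x ^ (q ^ j)) {..<e}"
proof (rule linorder_inj_onI')
  fix i j assume ij: "i \<in> {..<e}" "j \<in> {..<e}" "i < j"
  show "x ^ (q ^ i) \<noteq> x ^ (q ^ j)"
  proof
    assume "x ^ (q ^ i) = x ^ (q ^ j)"
    \<comment> \<open>The exponent e - j completes the right-hand side to a full period, so that x
      would already be fixed after i + e - j < e steps.\<close>
    hence "(x ^ (q ^ i)) ^ (q ^ (e - j)) = (x ^ (q ^ j)) ^ (q ^ (e - j))" by simp
    hence "x ^ (q ^ (i + (e - j))) = x ^ (q ^ e)"
      using ij by (simp add: power_mult[symmetric] power_add[symmetric])
    moreover have "1 \<le> i + (e - j)" "i + (e - j) < e" using ij by auto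
    ultimately show False
      using prime_monic_root_fixed[OF P] prime_monic_root_not_fixed[OF P, of "i + (e - j)"] by simp
  qed
qed

text \<open>Both sides are monic of degree e and vanish at the e distinct conjugates of x; equal
  leading coefficients make e points enough.\<close>

lemma prime_monic_eq_prod:
  assumes P: "P \<in> prime_monics e" "ev P x = 0"
  shows "map_poly \<iota> P = (\<Prod>j<e. [:- (x ^ (q ^ j)), 1:])"
proof -
  let ?f = "\<lambda>j. x ^ (q ^ j)"
  have m: "monic (\<Prod>j<e. [:- ?f j, 1:])" by (rule monic_prod) auto
  have d: "degree (\<Prod>j<e. [:- ?f j, 1:]) = e"
    by (subst degree_prod_sum_eq) auto
  show ?thesis
  proof (rule poly_eqI_degree_lead_coeff[where A = "?f ` {..<e}" and n = e])
    show "e \<le> card (?f ` {..<e})" using prime_monic_conjugates_inj[OF P] by (simp add: card_image)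
    show "poly (map_poly \<iota> P) z = poly (\<Prod>j<e. [:- ?f j, 1:]) z" if "z \<in> ?f ` {..<e}" for z
    proof -
      from that obtain i where i: "i < e" "z = ?f i" by auto
      hence "poly (\<Prod>j<e. [:- ?f j, 1:]) z = 0" by (auto simp: poly_prod)
      moreover have "poly (map_poly \<iota> P) z = 0"
        using P q_ge_2 by (simp add: i ev_power_q_power power_0_left)
      ultimately show ?thesis by simp
    qed
  qed (use P m d in \<open>auto simp: prime_monics_def monics_def\<close>)
qed

lemma prime_monic_roots:
  assumes P: "P \<in> prime_monics e" "ev P x = 0"
  shows "{y. ev P y = 0} = (\<lambda>j. x ^ (q ^ j)) ` {..<e}"
  unfolding prime_monic_eq_prod[OF P] by (auto simp: poly_prod)

lemma q_power_ge_2: "t \<ge> 1 \<Longrightarrow> q ^ t \<ge> 2"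
  using q_ge_2 self_le_power[of q t] by linarith

text \<open>This yields the minimal polynomial of x: x is a root of X^(q^t) - X, hence of one of its
  prime factors over the prime field.\<close>

lemma exists_prime_monic_root:
  assumes x: "x ^ (q ^ t) = (x :: 'a)" and t: "t \<ge> 1"
  shows "\<exists>e. \<exists>P\<in>prime_monics e. ev P x = 0"
proof -
  let ?f = "monom 1 (q ^ t) - monom 1 1 :: 'c mod_ring poly"
  have m: "?f \<in> monics (q ^ t)" using degree_Xpow_minus_X[OF q_power_ge_2[OF t]] by (simp add: monics_def)
  have f0: "?f \<noteq> 0" using monicsD(1)[OF m] by (metis coeff_0 zero_neq_one)
  have "(\<Prod>P\<in>prime_factors ?f. P ^ multiplicity P ?f) = ?f"
    using prod_prime_factors[OF f0] normalize_monic[OF monicsD(1)[OF m]] by simp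
  hence "ev (\<Prod>P\<in>prime_factors ?f. P ^ multiplicity P ?f) x = 0" using x ev_Xpow by simp
  hence "(\<Prod>P\<in>prime_factors ?f. ev P x ^ multiplicity P ?f) = 0"
    by (simp add: hom_distribs poly_prod)
  then obtain P where "P \<in> prime_factors ?f" "ev P x = 0" by auto
  thus ?thesis using prime_factors_monic[OF m] by (auto simp: prime_monics_def monics_def)
qed

lemma prime_monic_root_unique:
  assumes "P \<in> prime_monics e" "ev P x = 0" "Q \<in> prime_monics d" "ev Q x = 0"
  shows "P = Q"
proof -
  have "P dvd Q" "Q dvd P" using irreducible_dvd_of_root assms by (auto simp: prime_monics_def)
  hence "normalize P = normalize Q" by (simp add: associated_iff_dvd)
  moreover have "monic P" "monic Q" using assms by (auto simp: prime_monics_def monics_def)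
  ultimately show ?thesis using normalize_monic by metis
qed

text \<open>Once P has one root, its conjugates are all the roots. For existence write X^(q^t) - X =
  P r: if P had no root, all q^t fixed points would be roots of r, whose degree is smaller than
  q^t.\<close>

lemma card_prime_monic_roots:
  assumes P: "P \<in> prime_monics e" and e: "e dvd t" and t: "t \<ge> 1"
    and K: "card {x :: 'a. x ^ (q ^ t) = x} = q ^ t"
  shows "card {x. ev P x = 0} = e"
proof -
  have e0: "e > 0" using e t by (auto intro: Nat.gr0I)
  have qt: "q ^ t \<ge> 2" using t by (rule q_power_ge_2)
  have "\<exists>x. ev P x = 0"
  proof (rule ccontr)
    assume no: "\<nexists>x. ev P x = 0"
    have c: "[monom 1 (q ^ e) = monom 1 1] (mod P)"
      using prime_monic_dvd_Xpow[OF P] by (simp add: cong_iff_dvd_diff)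
    \<comment> \<open>Raising to the power q^e moves from k to k + 1, and X^(q^e) is congruent to X
      modulo P.\<close>
    have "[monom 1 (q ^ (e * k)) = monom 1 1] (mod P)" for k
    proof (induction k)
      case (Suc k)
      have "[monom 1 (q ^ (e * k)) ^ (q ^ e) = monom 1 1 ^ (q ^ e)] (mod P)"
        using Suc by (rule cong_pow)
      moreover have "monom 1 (q ^ (e * k)) ^ (q ^ e) = (monom 1 (q ^ (e * Suc k)) :: 'c mod_ring poly)"
        by (simp add: monom_power power_add mult.commute)
      ultimately show ?case using c by (metis monom_power mult_1 power_one cong_trans)
    qed simp
    moreover obtain k where "t = e * k" using e by (elim dvdE)
    ultimately have "P dvd monom 1 (q ^ t) - monom 1 1" by (simp add: cong_iff_dvd_diff)
    then obtain r where r: "monom 1 (q ^ t) - monom 1 1 = P * r" by (elim dvdE)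
    have "degree (monom 1 (q ^ t) - monom 1 1 :: 'c mod_ring poly) = q ^ t"
      by (rule degree_Xpow_minus_X[OF qt])
    moreover have "P \<noteq> 0" "r \<noteq> 0" using r degree_Xpow_minus_X(2)[OF qt, where 'b = "'c mod_ring"] by auto
    ultimately have "q ^ t = e + degree r"
      using P unfolding r by (simp add: degree_mult_eq prime_monics_def monics_def)
    hence "degree r < q ^ t" using e0 by simp
    moreover have sub: "{x. x ^ (q ^ t) = x} \<subseteq> {x. ev r x = 0}"
    proof safe
      fix x :: 'a assume "x ^ (q ^ t) = x"
      hence "ev (P * r) x = 0" unfolding r[symmetric] ev_Xpow by simp
      thus "ev r x = 0" using no by (simp add: hom_distribs)
    qed
    have "card {x :: 'a. x ^ (q ^ t) = x} \<le> card {x. ev r x = 0}"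
      by (intro card_mono sub) auto
    hence "q ^ t \<le> card {x. ev r x = 0}" using K by simp
    moreover have "card {x. ev r x = 0} \<le> degree r"
      using card_poly_roots_bound[of "map_poly \<iota> r"] \<open>r \<noteq> 0\<close> by simp
    ultimately show False by simp
  qed
  then obtain x where "ev P x = 0" by blast
  thus ?thesis using prime_monic_conjugates_inj[OF P] prime_monic_roots[OF P] by (simp add: card_image)
qed

end

section \<open>Trace and norm of elements lying in a smaller field\<close>

lemma power_power_periodic:
  assumes "x ^ (p ^ e) = (x :: 'a::monoid_mult)"
  shows "x ^ (p ^ (j + i * e)) = x ^ (p ^ j)"
proof (induction i)
  case (Suc i)
  have "x ^ (p ^ (j + Suc i * e)) = (x ^ (p ^ e)) ^ (p ^ (j + i * e))"
    by (simp add: power_mult[symmetric] power_add[symmetric] algebra_simps)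
  thus ?case using Suc assms by simp
qed simp

text \<open>The list of conjugates repeats after e terms. This serves twice: for the degree e of an
  element inside t, and for t inside m.\<close>

lemma ff_trace_periodic:
  assumes "x ^ (p ^ e) = (x :: 'a::field)"
  shows "ff_trace p (e * k) x = of_nat k * ff_trace p e x"
proof -
  have "ff_trace p (k * e) x = (\<Sum>i<k. \<Sum>j\<in>{i*e..<i*e+e}. x ^ (p ^ j))"
    unfolding ff_trace_def by (rule sum.nat_group[symmetric])
  also have "\<dots> = (\<Sum>i<k. ff_trace p e x)"
    unfolding ff_trace_def
  proof (rule sum.cong[OF refl])
    fix i
    have "(\<Sum>j\<in>{i*e..<i*e+e}. x ^ (p ^ j)) = (\<Sum>j<e. x ^ (p ^ (j + i * e)))"
      by (rule sum.reindex_bij_witness[of _ "\<lambda>j. j + i * e" "\<lambda>j. j - i * e"]) auto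
    thus "(\<Sum>j\<in>{i*e..<i*e+e}. x ^ (p ^ j)) = (\<Sum>j<e. x ^ (p ^ j))"
      by (simp add: power_power_periodic[OF assms])
  qed
  finally show ?thesis by (simp add: mult.commute)
qed

lemma ff_norm_periodic:
  assumes "x ^ (p ^ e) = (x :: 'a::field)"
  shows "ff_norm p (e * k) x = ff_norm p e x ^ k"
proof -
  have "ff_norm p (k * e) x = (\<Prod>i<k. \<Prod>j\<in>{i*e..<i*e+e}. x ^ (p ^ j))"
    unfolding ff_norm_def by (rule prod.nat_group[symmetric])
  also have "\<dots> = (\<Prod>i<k. ff_norm p e x)"
    unfolding ff_norm_def
  proof (rule prod.cong[OF refl])
    fix i
    have "(\<Prod>j\<in>{i*e..<i*e+e}. x ^ (p ^ j)) = (\<Prod>j<e. x ^ (p ^ (j + i * e)))"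
      by (rule prod.reindex_bij_witness[of _ "\<lambda>j. j + i * e" "\<lambda>j. j - i * e"]) auto
    thus "(\<Prod>j\<in>{i*e..<i*e+e}. x ^ (p ^ j)) = (\<Prod>j<e. x ^ (p ^ j))"
      by (simp add: power_power_periodic[OF assms])
  qed
  finally show ?thesis by (simp add: mult.commute)
qed

locale cubic_character_extension = prime_field_embedding \<iota> q + cubic_character \<chi>
  for \<iota> :: "'c::prime_card mod_ring \<Rightarrow> 'a::finite_field" and q and \<chi> :: "'c mod_ring \<Rightarrow> complex"
begin

lemma ff_trace_prime_monic_root:
  assumes P: "P \<in> prime_monics e" "ev P x = 0" and e: "e dvd t"
  shows "ff_trace q t x = \<iota> (of_nat (t div e) * poly_trace P)"
proof -
  have "\<iota> (poly_trace P) = poly_trace (map_poly \<iota> P)" by (rule poly_trace_map_poly[symmetric])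
  also have "\<dots> = ff_trace q e x"
    unfolding prime_monic_eq_prod[OF P] poly_trace_prod_linear ff_trace_def ..
  finally show ?thesis
    using ff_trace_periodic[OF prime_monic_root_fixed[OF P], of "t div e"] e by (simp add: hom_distribs)
qed

lemma ff_norm_prime_monic_root:
  assumes P: "P \<in> prime_monics e" "ev P x = 0" and e: "e dvd t"
  shows "ff_norm q t x = \<iota> (((- 1) ^ e * coeff P 0) ^ (t div e))"
proof -
  have "\<iota> (coeff P 0) = coeff (map_poly \<iota> P) 0" by simp
  also have "\<dots> = (- 1) ^ e * ff_norm q e x"
    unfolding prime_monic_eq_prod[OF P] coeff_0_prod_linear ff_norm_def by simp
  finally have "\<iota> ((- 1) ^ e * coeff P 0) = ff_norm q e x"
    by (simp add: hom_distribs flip: mult.assoc power_mult_distrib)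
  thus ?thesis
    using ff_norm_periodic[OF prime_monic_root_fixed[OF P], of "t div e"] e by (simp add: hom_distribs)
qed

text \<open>The field with q^t elements is the disjoint union of the root sets of the monic
  irreducible P of degree e dividing t. Each set has e members, which accounts for the factor e, and
  trace and norm on it are those that \<open>monic_weight P ^ (t div e)\<close> encodes.\<close>

lemma sum_fixed_eq_mangoldt_sum:
  assumes K: "card {x :: 'a. x ^ (q ^ t) = x} = q ^ t" and t: "t \<ge> 1"
  shows "(\<Sum>x | x ^ (q ^ t) = x. Poly_Mapping.single (iota_inv (ff_trace q t x)) (\<chi> (iota_inv (ff_norm q t x)))) =
    mangoldt_sum monic_weight t"
proof -
  let ?S = "SIGMA e:{e. e dvd t}. (prime_monics e :: 'c mod_ring poly set)"
  let ?F = "\<lambda>x. Poly_Mapping.single (iota_inv (ff_trace q t x)) (\<chi> (iota_inv (ff_norm q t x)))"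
  have F: "?F x = monic_weight P ^ (t div e)" if P: "P \<in> prime_monics e" "ev P x = 0" and e: "e dvd t" for e P x
  proof -
    have pow: "monic_weight P ^ k = Poly_Mapping.single (of_nat k * poly_trace P) (\<chi> (coeff P 0) ^ k)" for k
      by (induction k) (auto simp: single_one monic_weight_def mult_single algebra_simps)
    have "\<chi> (((- 1) ^ e * coeff P 0) ^ k) = \<chi> (coeff P 0) ^ k" for k
      using chi_minus[of 1] by (simp add: chi_power del: chi_minus)
    thus ?thesis
      unfolding pow ff_trace_prime_monic_root[OF that] ff_norm_prime_monic_root[OF that] by simp
  qed
  have U: "{x :: 'a. x ^ (q ^ t) = x} = (\<Union>(e, P)\<in>?S. {x. ev P x = 0})"
  proof (intro equalityI subsetI)
    fix x :: 'a assume "x \<in> {x. x ^ (q ^ t) = x}"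
    hence x: "x ^ (q ^ t) = x" by simp
    then obtain e P where P: "P \<in> prime_monics e" "ev P x = 0"
      using exists_prime_monic_root[OF x t] by blast
    moreover have "e dvd t" using prime_monic_root_fixed_iff[OF P] x by simp
    ultimately show "x \<in> (\<Union>(e, P)\<in>?S. {x. ev P x = 0})" by auto
  next
    fix x :: 'a assume "x \<in> (\<Union>(e, P)\<in>?S. {x. ev P x = 0})"
    thus "x \<in> {x. x ^ (q ^ t) = x}" using prime_monic_root_fixed_iff by auto
  qed
  have "(\<Sum>x | x ^ (q ^ t) = x. ?F x) = (\<Sum>s\<in>?S. \<Sum>x\<in>{x. ev (snd s) x = 0}. ?F x)"
    unfolding U case_prod_unfold
  proof (rule sum.UNION_disjoint)
    show "finite ?S" using t by (intro finite_SigmaI finite_divisors_nat) auto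
    show "\<forall>s\<in>?S. \<forall>s'\<in>?S. s \<noteq> s' \<longrightarrow> {x. ev (snd s) x = 0} \<inter> {x. ev (snd s') x = 0} = {}"
    proof (intro ballI impI equals0I)
      fix s s' x assume s: "s \<in> ?S" "s' \<in> ?S" "s \<noteq> s'" and x: "x \<in> {x. ev (snd s) x = 0} \<inter> {x. ev (snd s') x = 0}"
      hence "snd s = snd s'" using prime_monic_root_unique[of "snd s" "fst s" x "snd s'" "fst s'"] by auto
      moreover from this s have "fst s = fst s'" by (auto simp: prime_monics_def monics_def)
      ultimately show False using s by (simp add: prod_eq_iff)
    qed
  qed auto
  also have "\<dots> = (\<Sum>s\<in>?S. of_nat (fst s) * monic_weight (snd s) ^ (t div fst s))"
  proof (rule sum.cong[OF refl])
    fix s assume "s \<in> ?S"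
    hence s: "fst s dvd t" "snd s \<in> prime_monics (fst s)" by auto
    have "(\<Sum>x\<in>{x. ev (snd s) x = 0}. ?F x) = (\<Sum>x\<in>{x. ev (snd s) x = 0}. monic_weight (snd s) ^ (t div fst s))"
      using s by (intro sum.cong refl F) auto
    thus "(\<Sum>x\<in>{x. ev (snd s) x = 0}. ?F x) = of_nat (fst s) * monic_weight (snd s) ^ (t div fst s)"
      using card_prime_monic_roots[OF s(2,1) t K] by simp
  qed
  also have "\<dots> = mangoldt_sum monic_weight t"
    unfolding mangoldt_sum_def using t by (subst sum.Sigma) (auto simp: case_prod_unfold intro!: finite_divisors_nat)
  finally show ?thesis .
qed

lemma sum_chi_norm_fixed_trace:
  assumes K: "card {x :: 'a. x ^ (q ^ t) = x} = q ^ t" and t: "t \<ge> 1"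
  shows "(\<Sum>x | x ^ (q ^ t) = x \<and> ff_trace q t x = \<iota> c. \<chi> (iota_inv (ff_norm q t x))) =
    (- 1) ^ (t - 1) * Poly_Mapping.lookup (gauss ^ t) c"
proof -
  \<comment> \<open>Off the range of \<open>\<iota>\<close> the value of \<open>iota_inv\<close> is
    arbitrary, so the trace must first be known to lie in the prime field.\<close>
  have tr: "iota_inv (ff_trace q t x) = c \<longleftrightarrow> ff_trace q t x = \<iota> c" if x: "x ^ (q ^ t) = x" for x
  proof -
    obtain e P where P: "P \<in> prime_monics e" "ev P x = 0"
      using exists_prime_monic_root[OF x t] by blast
    moreover have "e dvd t" using prime_monic_root_fixed_iff[OF P] x by simp
    ultimately obtain y where "ff_trace q t x = \<iota> y" using ff_trace_prime_monic_root by blast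
    thus ?thesis by simp
  qed
  have "(\<Sum>x | x ^ (q ^ t) = x \<and> ff_trace q t x = \<iota> c. \<chi> (iota_inv (ff_norm q t x))) =
    (\<Sum>x | x ^ (q ^ t) = x. if ff_trace q t x = \<iota> c then \<chi> (iota_inv (ff_norm q t x)) else 0)"
    by (simp add: sum.inter_filter[symmetric] Collect_conj_eq[symmetric])
  also have "\<dots> = (\<Sum>x | x ^ (q ^ t) = x. Poly_Mapping.lookup
      (Poly_Mapping.single (iota_inv (ff_trace q t x)) (\<chi> (iota_inv (ff_norm q t x)))) c)"
    by (intro sum.cong refl) (auto simp: lookup_single when_def tr)
  also have "\<dots> = Poly_Mapping.lookup (mangoldt_sum monic_weight t) c"
    by (simp add: lookup_sum flip: sum_fixed_eq_mangoldt_sum[OF K t])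
  finally show ?thesis using lookup_mangoldt_sum[OF t] by simp
qed

end

section \<open>The cubic Jacobi sum\<close>

lemma zeta3_eq: "zeta3 = (- 1 + \<i> * of_real (sqrt 3)) / 2"
proof -
  have "zeta3 = cis (2 * pi / 3)"
    by (simp add: zeta3_def cis_conv_exp mult_ac)
  thus ?thesis by (simp add: complex_eq_iff cos_120 sin_120)
qed

lemma zeta3_cube: "zeta3 ^ 3 = 1" and zeta3_sum: "1 + zeta3 + zeta3 ^ 2 = 0" and zeta3_neq_1: "zeta3 \<noteq> 1"
proof -
  have s: "complex_of_real (sqrt 3) ^ 2 = 3" by (simp flip: of_real_power)
  show sum: "1 + zeta3 + zeta3 ^ 2 = 0"
    unfolding zeta3_eq using s by (simp add: field_simps power2_eq_square)
  have "zeta3 ^ 3 - 1 = (zeta3 - 1) * (1 + zeta3 + zeta3 ^ 2)"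
    by (simp add: algebra_simps power3_eq_cube power2_eq_square)
  thus "zeta3 ^ 3 = 1" using sum by simp
  show "zeta3 \<noteq> 1" by (simp add: zeta3_eq complex_eq_iff)
qed

lemma power_mod_3:
  fixes z :: "'a::monoid_mult"
  assumes "z ^ 3 = 1" shows "z ^ (n mod 3) = z ^ n"
proof -
  have "z ^ n = z ^ (n mod 3 + 3 * (n div 3))" by simp
  also have "\<dots> = z ^ (n mod 3)" by (simp only: power_add power_mult assms power_one mult_1_right)
  finally show ?thesis ..
qed

lemma zeta3_power_eq_iff: "zeta3 ^ m = zeta3 ^ n \<longleftrightarrow> m mod 3 = n mod 3"
proof
  assume eq: "zeta3 ^ m = zeta3 ^ n"
  have ne: "zeta3 ^ 2 \<noteq> 1" "zeta3 ^ 2 \<noteq> zeta3"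
    using zeta3_cube zeta3_neq_1 zeta3_sum by (auto simp: power3_eq_cube power2_eq_square)
  have "zeta3 ^ (m mod 3) = zeta3 ^ (n mod 3)" using eq power_mod_3[OF zeta3_cube] by metis
  moreover have "m mod 3 \<in> {0, 1, 2}" "n mod 3 \<in> {0, 1, 2}" by auto
  ultimately show "m mod 3 = n mod 3" using ne zeta3_neq_1 by auto
next
  assume "m mod 3 = n mod 3"
  thus "zeta3 ^ m = zeta3 ^ n" using power_mod_3[OF zeta3_cube] by metis
qed

lemma even_card_involution:
  assumes "finite A" and "\<And>x. x \<in> A \<Longrightarrow> f x \<in> A" "\<And>x. x \<in> A \<Longrightarrow> f (f x) = x" "\<And>x. x \<in> A \<Longrightarrow> f x \<noteq> x"
  shows "even (card A)"
  using assms
proof (induction "card A" arbitrary: A rule: less_induct)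
  case less
  show ?case
  proof (cases "A = {}")
    case False
    then obtain x where x: "x \<in> A" by blast
    have "card A = card (A - {x, f x}) + card {x, f x}"
      using less.prems x by (metis card_Diff_subset card_mono empty_subsetI finite.emptyI finite_insert insert_subset le_add_diff_inverse2)
    moreover have "card {x, f x} = 2" using less.prems(4)[OF x] by simp
    moreover have "even (card (A - {x, f x}))"
    proof (rule less.hyps)
      show "card (A - {x, f x}) < card A" using x less.prems(1) by (intro psubset_card_mono) auto
      show "f y \<in> A - {x, f x}" if "y \<in> A - {x, f x}" for y
        using that less.prems(2,3) x by (metis Diff_iff insert_iff singletonD)
    qed (use less.prems in auto)
    ultimately show ?thesis by simp
  qed simp
qed

text \<open>
  The divisibility by \<open>p\<close> selects one of the two conjugate primes above \<open>p\<close> in the Eisenstein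
  integers, and the congruences modulo 3 select its associate.
\<close>

lemma eisenstein_representation_unique:
  fixes a b a' b' p :: int
  assumes p: "p > 0" and ab: "a\<^sup>2 + 3 * b\<^sup>2 = p" and ab': "a'\<^sup>2 + 3 * b'\<^sup>2 = p"
    and dvd: "p dvd a * b' - a' * b" and "[a = - 1] (mod 3)" "[a' = - 1] (mod 3)"
  shows "a = a' \<and> b = b'"
proof -
  have brahmagupta: "p\<^sup>2 = (a * a' + 3 * b * b')\<^sup>2 + 3 * (a * b' - a' * b)\<^sup>2"
  proof -
    have "p\<^sup>2 = (a\<^sup>2 + 3 * b\<^sup>2) * (a'\<^sup>2 + 3 * b'\<^sup>2)" unfolding ab ab' by (rule power2_eq_square)
    thus ?thesis by (simp add: power2_eq_square algebra_simps)
  qed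
  obtain k where k: "a * b' - a' * b = p * k" using dvd by (elim dvdE)
  \<comment> \<open>If k were nonzero, the term 3 (p k)^2 alone would exceed p^2 in the Brahmagupta
    identity.\<close>
  have "k = 0"
  proof (rule ccontr)
    assume "k \<noteq> 0"
    hence "1 \<le> k\<^sup>2" by (simp add: int_one_le_iff_zero_less)
    hence "p\<^sup>2 * 1 \<le> p\<^sup>2 * k\<^sup>2" by (intro mult_left_mono) auto
    moreover have "3 * (p\<^sup>2 * k\<^sup>2) \<le> p\<^sup>2"
      using brahmagupta zero_le_power2[of "a * a' + 3 * b * b'"] unfolding k power_mult_distrib by linarith
    ultimately have "p\<^sup>2 \<le> 0" by linarith
    thus False using p by simp
  qed
  hence cross: "a * b' = a' * b" using k by simp
  have "(a * a' + 3 * b * b')\<^sup>2 = p\<^sup>2" using brahmagupta cross by simp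
  hence "a * a' + 3 * b * b' = p \<or> a * a' + 3 * b * b' = - p" by (simp add: power2_eq_iff)
  \<comment> \<open>With a a' + 3 b b' equal to p or -p, this product and the next one show that
    (a', b') is (a, b) up to a common sign; the congruences modulo 3 decide the sign.\<close>
  moreover have "a * (a * a' + 3 * b * b') = p * a'"
  proof -
    have "a * (a * a' + 3 * b * b') = a\<^sup>2 * a' + 3 * b * (a * b')"
      by (simp add: power2_eq_square algebra_simps)
    also have "\<dots> = (a\<^sup>2 + 3 * b\<^sup>2) * a'" unfolding cross by (simp add: power2_eq_square algebra_simps)
    finally show ?thesis unfolding ab .
  qed
  moreover have "b * (a * a' + 3 * b * b') = p * b'"
  proof -
    have "b * (a * a' + 3 * b * b') = a * (a' * b) + 3 * b\<^sup>2 * b'"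
      by (simp add: power2_eq_square algebra_simps)
    also have "\<dots> = (a\<^sup>2 + 3 * b\<^sup>2) * b'" unfolding cross[symmetric] by (simp add: power2_eq_square algebra_simps)
    finally show ?thesis unfolding ab .
  qed
  ultimately have "(p * a' = p * a \<and> p * b' = p * b) \<or> (p * a' = p * (- a) \<and> p * b' = p * (- b))"
    by (auto simp: mult.commute)
  hence "(a' = a \<and> b' = b) \<or> (a' = - a \<and> b' = - b)"
    using p by (simp del: mult_minus_right)
  moreover have "a' \<noteq> - a"
  proof
    assume "a' = - a"
    with assms(5,6) have "3 dvd a + 1" "3 dvd - a + 1" by (simp_all add: cong_iff_dvd_diff)
    hence "3 dvd (a + 1) + (- a + 1)" by (rule dvd_add)
    thus False by simp
  qed
  ultimately show ?thesis by auto
qed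

text \<open>A nonzero remainder r of j would also satisfy \<open>g ^ r = 1\<close>, leaving at most
  r powers of g, too few for all nonzero elements.\<close>

lemma generator_power_eq_1_imp_dvd:
  fixes g :: "'b::{finite, field}"
  assumes gen: "\<And>x. x \<noteq> 0 \<Longrightarrow> \<exists>k. x = g ^ k" and j: "g ^ j = 1" and ord: "g ^ (CARD('b) - 1) = 1"
  shows "(CARD('b) - 1) dvd j"
proof -
  have mod_eq: "g ^ (k mod l) = g ^ k" if "g ^ l = 1" for k l
  proof -
    have "g ^ k = g ^ (k mod l + l * (k div l))" by simp
    also have "\<dots> = g ^ (k mod l)" by (simp only: power_add power_mult that power_one mult_1_right)
    finally show ?thesis ..
  qed
  define r where "r = j mod (CARD('b) - 1)"
  have "CARD('b) > 1" using card_mono[of UNIV "{0, 1 :: 'b}"] by simp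
  hence r: "r < CARD('b) - 1" by (simp add: r_def)
  have gr: "g ^ r = 1" unfolding r_def using mod_eq[OF ord] j by simp
  have "r = 0"
  proof (rule ccontr)
    assume "r \<noteq> 0"
    have "UNIV - {0} \<subseteq> (\<lambda>i. g ^ i) ` {..<r}"
    proof
      fix x :: 'b assume "x \<in> UNIV - {0}"
      then obtain k where "x = g ^ k" using gen by auto
      thus "x \<in> (\<lambda>i. g ^ i) ` {..<r}"
        using mod_eq[OF gr, of k] \<open>r \<noteq> 0\<close> by (intro image_eqI[of _ _ "k mod r"]) auto
    qed
    hence "card (UNIV - {0 :: 'b}) \<le> card ((\<lambda>i. g ^ i) ` {..<r})" by (intro card_mono) auto
    also have "\<dots> \<le> r" using card_image_le[of "{..<r}" "\<lambda>i. g ^ i"] by simp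
    finally show False using r by (simp add: card_Diff_singleton)
  qed
  thus ?thesis unfolding r_def by (simp add: mod_eq_0_iff_dvd)
qed

text \<open>Translation by 1 permutes the ring, so adding 1 to every summand leaves the sum of all
  elements unchanged.\<close>

lemma of_nat_card_eq_0: "of_nat CARD('b) = (0 :: 'b::{finite, ring_1})"
proof -
  have "(\<Sum>v\<in>UNIV. v + 1) = (\<Sum>v\<in>UNIV. v :: 'b)"
    by (rule sum.reindex_bij_witness[of _ "\<lambda>v. v - 1" "\<lambda>v. v + 1"]) auto
  thus ?thesis by (simp add: sum.distrib)
qed

lemma card_field_ge_2: "CARD('b::{finite, field}) \<ge> 2"
  using card_mono[of UNIV "{0, 1 :: 'b}"] by simp

lemma power_card_minus_1:
  fixes x :: "'b::finite_field"
  assumes "x \<noteq> 0" shows "x ^ (CARD('b) - 1) = 1"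
  using finite_field_power_card_eq_same[of x] power_minus_mult[of "CARD('b)" x]
    card_field_ge_2[where 'b = 'b] assms by simp

section \<open>Evaluation of the Jacobi sum from the cubic classes of 1 - v^2\<close>

locale cubic_character_generator = cubic_character \<chi>
  for \<chi> :: "'b::{finite_field, field_gcd} \<Rightarrow> complex" +
  fixes g :: 'b
  assumes gen: "x \<noteq> 0 \<Longrightarrow> \<exists>k. x = g ^ k" and g_nonzero: "g \<noteq> 0"
    and chi_g: "\<chi> g = zeta3" and two_nonzero: "(2 :: 'b) \<noteq> 0"
begin

definition N :: nat where "N = (CARD('b) - 1) div 3"
text \<open>The primitive cube root of unity in the field that plays the role of
  \<open>zeta3\<close>.\<close>

definition w :: 'b where "w = g ^ N"



lemma g_power_neq_1: "0 < j \<Longrightarrow> j < CARD('b) - 1 \<Longrightarrow> g ^ j \<noteq> 1"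
  using generator_power_eq_1_imp_dvd[OF gen _ power_card_minus_1[OF g_nonzero], of j]
  by (metis dvd_imp_le not_le)

lemma card_eq: "CARD('b) = 3 * N + 1" and N_pos: "N > 0"
proof -
  have "zeta3 ^ (CARD('b) - 1) = 1"
    using chi_power[of g "CARD('b) - 1"] by (simp only: power_card_minus_1[OF g_nonzero] chi_g chi_1)
  hence "(CARD('b) - 1) mod 3 = 0" using zeta3_power_eq_iff[of "CARD('b) - 1" 0] by simp
  hence "CARD('b) - 1 = 3 * N" unfolding N_def by (metis mod_0_imp_dvd dvd_mult_div_cancel)
  with card_field_ge_2[where 'b = 'b] show "CARD('b) = 3 * N + 1" "N > 0" by auto
qed

lemma w_cube: "w ^ 3 = 1"
  using power_card_minus_1[OF g_nonzero] by (simp add: w_def card_eq mult.commute flip: power_mult)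

lemma w_sum: "1 + w + w ^ 2 = 0"
proof -
  have "w \<noteq> 1" unfolding w_def using N_pos by (intro g_power_neq_1) (auto simp: card_eq)
  moreover have "(w - 1) * (1 + w + w ^ 2) = w ^ 3 - 1"
    by (simp add: algebra_simps power3_eq_cube power2_eq_square)
  ultimately show ?thesis using w_cube by simp
qed

text \<open>Euler's criterion for cubes: the N-th power reproduces inside the field the value that
  \<open>\<chi>\<close> takes among the complex numbers.\<close>

lemma chi_eq_imp_power_eq:
  assumes "x \<noteq> 0" "\<chi> x = zeta3 ^ i" shows "x ^ N = w ^ i"
proof -
  obtain k where k: "x = g ^ k" using gen assms by blast
  hence "zeta3 ^ k = zeta3 ^ i" using assms by (simp add: chi_power chi_g)
  hence "k mod 3 = i mod 3" by (simp add: zeta3_power_eq_iff)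
  hence "w ^ k = w ^ i" using power_mod_3[OF w_cube] by metis
  thus ?thesis by (simp add: k w_def mult.commute flip: power_mult)
qed

text \<open>Replacing v by g v multiplies the sum by \<open>g ^ j\<close>, which is not 1 for 0 < j
  < CARD - 1. For j = 0 every v contributes 1, also v = 0, and CARD vanishes in the field.\<close>

lemma sum_powers_eq_0:
  assumes "j < CARD('b) - 1" shows "(\<Sum>v\<in>UNIV. v ^ j :: 'b) = 0"
proof (cases "j = 0")
  case True
  thus ?thesis by (simp add: of_nat_card_eq_0)
next
  case False
  have "(\<Sum>v\<in>UNIV. v ^ j) = (\<Sum>v\<in>UNIV. (g * v) ^ j)"
    by (rule sum.reindex_bij_witness[of _ "\<lambda>x. g * x" "\<lambda>x. x / g"]) (use g_nonzero in auto)
  also have "\<dots> = g ^ j * (\<Sum>v\<in>UNIV. v ^ j)" by (simp add: sum_distrib_left power_mult_distrib)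
  finally have "(g ^ j - 1) * (\<Sum>v\<in>UNIV. v ^ j) = 0" by (simp add: algebra_simps)
  thus ?thesis using g_power_neq_1[of j] False assms by simp
qed

text \<open>The degree 2 N stays below CARD - 1 = 3 N, so every monomial sums to 0.\<close>

lemma sum_one_minus_square_power: "(\<Sum>v\<in>UNIV. (1 - v ^ 2) ^ N :: 'b) = 0"
proof -
  have "(1 - v ^ 2) ^ N = (\<Sum>k\<le>N. of_nat (N choose k) * (- 1) ^ k * v ^ (2 * k))" for v :: 'b
    using binomial_ring[of "- (v ^ 2)" 1 N]
    by (simp add: power_minus[of "v ^ 2"] power_mult mult.assoc)
  hence "(\<Sum>v\<in>UNIV. (1 - v ^ 2) ^ N :: 'b) = (\<Sum>v\<in>UNIV. \<Sum>k\<le>N. of_nat (N choose k) * (- 1) ^ k * v ^ (2 * k))"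
    by simp
  also have "\<dots> = (\<Sum>k\<le>N. of_nat (N choose k) * (- 1) ^ k * (\<Sum>v\<in>UNIV. v ^ (2 * k)))"
    by (subst sum.swap) (simp add: sum_distrib_left)
  also have "\<dots> = 0"
    using N_pos by (intro sum.neutral ballI) (simp add: sum_powers_eq_0 card_eq)
  finally show ?thesis .
qed

definition chi_class :: "nat \<Rightarrow> 'b set" where
  "chi_class i = {v. 1 - v ^ 2 \<noteq> 0 \<and> \<chi> (1 - v ^ 2) = zeta3 ^ i}"

lemma sum_over_classes:
  fixes f :: "'b \<Rightarrow> 'r::comm_monoid_add"
  shows "(\<Sum>v\<in>{v. 1 - v ^ 2 \<noteq> 0}. f v) = (\<Sum>v\<in>chi_class 0. f v) + (\<Sum>v\<in>chi_class 1. f v) + (\<Sum>v\<in>chi_class 2. f v)"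
proof -
  have "\<exists>i\<in>{0, 1, 2}. \<chi> x = zeta3 ^ i" if x: "x \<noteq> 0" for x
  proof -
    obtain k where "x = g ^ k" using gen x by blast
    hence "\<chi> x = zeta3 ^ (k mod 3)" by (simp add: chi_power chi_g power_mod_3[OF zeta3_cube])
    thus ?thesis by (intro bexI[of _ "k mod 3"]) auto
  qed
  hence U: "{v. 1 - v ^ 2 \<noteq> 0} = chi_class 0 \<union> chi_class 1 \<union> chi_class 2" unfolding chi_class_def by blast
  have D: "chi_class i \<inter> chi_class j = {}" if "i mod 3 \<noteq> j mod 3" for i j
    using that zeta3_power_eq_iff by (auto simp: chi_class_def)
  have "(chi_class 0 \<union> chi_class 1) \<inter> chi_class 2 = {}" using D[of 0 2] D[of 1 2] by auto
  thus ?thesis unfolding U using D[of 0 1] by (simp add: sum.union_disjoint)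
qed

lemma chi_4_jacobi:
  "\<chi> 4 * jacobi = of_nat (card (chi_class 0)) + of_nat (card (chi_class 1)) * zeta3 + of_nat (card (chi_class 2)) * zeta3 ^ 2"
proof -
  have "\<chi> 4 * jacobi = (\<Sum>u\<in>UNIV. \<chi> (4 * u * (1 - u)))"
    by (simp add: jacobi_def sum_distrib_left mult.assoc)
  \<comment> \<open>Completing the square: 4 u (1 - u) = 1 - (1 - 2 u)^2.\<close>
  also have "\<dots> = (\<Sum>v\<in>UNIV. \<chi> (1 - v ^ 2))"
    by (rule sum.reindex_bij_witness[of _ "\<lambda>v. (1 - v) / 2" "\<lambda>u. 1 - 2 * u"])
       (use two_nonzero in \<open>auto simp: field_simps power2_eq_square\<close>)
  also have "\<dots> = (\<Sum>v\<in>{v. 1 - v ^ 2 \<noteq> 0}. \<chi> (1 - v ^ 2))"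
    by (rule sum.mono_neutral_right) auto
  also have "\<dots> = (\<Sum>v\<in>chi_class 0. zeta3 ^ 0) + (\<Sum>v\<in>chi_class 1. zeta3 ^ 1) + (\<Sum>v\<in>chi_class 2. zeta3 ^ 2)"
    unfolding sum_over_classes by (intro arg_cong2[where f = "(+)"] sum.cong) (auto simp: chi_class_def)
  finally show ?thesis by simp
qed

text \<open>The decomposition of \<open>\<chi> 4 * jacobi\<close> with \<open>w\<close> in place of
  \<open>zeta3\<close>: the Jacobi sum vanishes modulo the prime above p at which
  \<open>zeta3\<close> reduces to \<open>w\<close>.\<close>

lemma card_classes_w:
  "of_nat (card (chi_class 0)) + of_nat (card (chi_class 1)) * w + of_nat (card (chi_class 2)) * w ^ 2 = (0 :: 'b)"
proof -
  have "0 = (\<Sum>v\<in>UNIV. (1 - v ^ 2) ^ N :: 'b)" by (simp add: sum_one_minus_square_power)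
  also have "\<dots> = (\<Sum>v\<in>{v. 1 - v ^ 2 \<noteq> 0}. (1 - v ^ 2) ^ N)"
    using N_pos by (intro sum.mono_neutral_right) auto
  also have "\<dots> = (\<Sum>v\<in>chi_class 0. w ^ 0) + (\<Sum>v\<in>chi_class 1. w ^ 1) + (\<Sum>v\<in>chi_class 2. w ^ 2)"
    unfolding sum_over_classes
    by (intro arg_cong2[where f = "(+)"] sum.cong chi_eq_imp_power_eq) (auto simp: chi_class_def)
  finally show ?thesis by simp
qed

lemma card_classes_sum: "card (chi_class 0) + card (chi_class 1) + card (chi_class 2) = CARD('b) - 2"
proof -
  have "card (chi_class 0) + card (chi_class 1) + card (chi_class 2) = (\<Sum>v\<in>{v :: 'b. 1 - v ^ 2 \<noteq> 0}. 1)"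
    unfolding sum_over_classes by simp
  also have "\<dots> = card (UNIV - {1, - 1 :: 'b})"
    by (simp add: power2_eq_1_iff Compl_eq_Diff_UNIV[symmetric] Compl_eq)
  also have "\<dots> = CARD('b) - card {1, - 1 :: 'b}" by (rule card_Diff_subset) auto
  also have "card {1, - 1 :: 'b} = 2"
    using two_nonzero by (metis card_2_iff add_eq_0_iff one_add_one)
  finally show ?thesis .
qed

text \<open>The sign change v -> -v preserves each class, and its only fixed point v = 0 has 1 - v^2
  = 1, which lies in class 0.\<close>

lemma even_card_chi_class:
  assumes "i \<in> {1, 2}" shows "even (card (chi_class i))"
proof (rule even_card_involution[where f = uminus])
  show "- v \<noteq> v" if "v \<in> chi_class i" for v
  proof
    assume "- v = v"
    hence "2 * v = 0" by (metis add.right_inverse mult_2)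
    hence "v = 0" using two_nonzero by simp
    hence "zeta3 ^ i = zeta3 ^ 0" using that by (simp add: chi_class_def)
    thus False using assms unfolding zeta3_power_eq_iff by auto
  qed
qed (auto simp: chi_class_def)

theorem jacobi_eq:
  assumes p: "prime CARD('b)" "CHAR('b) = CARD('b)"
    and ab: "a\<^sup>2 + 3 * b\<^sup>2 = int CARD('b)" and a: "[a = - 1] (mod 3)"
    and c: "of_int (3 * b) = (2 * g ^ ((CARD('b) - 1) div 3) + 1) * (of_int a :: 'b)"
  shows "jacobi = \<chi> 2 * (of_int a + \<i> * of_int b * of_real (sqrt 3))"
proof -
  let ?z = "\<lambda>a b. of_int a + \<i> * of_int b * of_real (sqrt 3) :: complex"
  obtain k1 k2 where k: "card (chi_class 1) = 2 * k1" "card (chi_class 2) = 2 * k2"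
    using even_card_chi_class[of 1] even_card_chi_class[of 2] by (auto elim!: evenE)
  \<comment> \<open>From 2 zeta = -1 + i sqrt 3 and 2 zeta^2 = -1 - i sqrt 3; the even class sizes 2
    k1 and 2 k2 make both coordinates integers.\<close>
  define a' b' where "a' = int (card (chi_class 0)) - int k1 - int k2" and "b' = int k1 - int k2"
  have z2: "zeta3 ^ 2 = - 1 - zeta3" using zeta3_sum by (simp add: eq_diff_eq eq_neg_iff_add_eq_0 add_ac)
  have K: "\<chi> 4 * jacobi = ?z a' b'"
    unfolding chi_4_jacobi k z2 unfolding a'_def b'_def zeta3_eq
    by (simp add: complex_eq_iff algebra_simps)
  have chi4: "\<chi> 4 = \<chi> 2 ^ 2" using chi_mult[of 2 2] by (simp add: power2_eq_square)
  \<comment> \<open>\<open>\<chi> 8 = \<chi> 2 ^ 3 = 1\<close>, so \<open>\<chi> 4\<close> moves to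
    the other side as \<open>\<chi> 2\<close>. This is the origin of that factor in the
    claim.\<close>
  have "\<chi> 2 * (\<chi> 4 * jacobi) = jacobi"
    using chi_cube'[OF two_nonzero] by (simp add: chi4 mult.assoc[symmetric])
  hence J: "jacobi = \<chi> 2 * ?z a' b'" using K by simp
  have "of_int (a'\<^sup>2 + 3 * b'\<^sup>2) = ?z a' b' * cnj (?z a' b')"
    by (simp add: algebra_simps power2_eq_square) (simp flip: of_real_mult)
  also have "\<dots> = (\<chi> 4 * cnj (\<chi> 4)) * (jacobi * cnj jacobi)" unfolding K[symmetric] by (simp add: mult_ac)
  also have "\<chi> 4 * cnj (\<chi> 4) = 1"
  proof -
    have "(4 :: 'b) = 2 * 2" by simp
    hence "(4 :: 'b) \<noteq> 0" using two_nonzero by (metis mult_eq_0_iff)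
    thus ?thesis unfolding cnj_chi by (rule chi_cube')
  qed
  finally have "of_int (a'\<^sup>2 + 3 * b'\<^sup>2) = (of_int (int CARD('b)) :: complex)" by (simp add: norm_jacobi)
  hence ab': "a'\<^sup>2 + 3 * b'\<^sup>2 = int CARD('b)" by (simp only: of_int_eq_iff)
  \<comment> \<open>The class sizes add up to CARD - 2 = 3 N - 1, since 1 - v^2 vanishes exactly at
    1 and -1; \<open>a'\<close> differs from this by a multiple of 3.\<close>
  have "a' = int (card (chi_class 0) + card (chi_class 1) + card (chi_class 2)) - 3 * (int k1 + int k2)"
    unfolding k a'_def by simp
  also have "\<dots> = 3 * (int N - int k1 - int k2) - 1"
    unfolding card_classes_sum card_eq using N_pos by (simp add: of_nat_diff algebra_simps)
  finally have a': "[a' = - 1] (mod 3)" by (simp add: cong_iff_dvd_diff)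
  have w2: "w ^ 2 = - 1 - w" using w_sum by (simp add: eq_diff_eq eq_neg_iff_add_eq_0 add_ac)
  \<comment> \<open>In the field 2 w + 1 stands for i sqrt 3, its square being -3. Hypothesis
    \<open>c\<close>, multiplied by 2 w + 1, gives up to the factor 3 the same linear relation for a
    and b. Hence a b' - a' b vanishes modulo p, as p > 3.\<close>
  have c1: "of_int a' + of_int b' * (2 * w + 1) = (0 :: 'b)"
    using card_classes_w unfolding k w2 a'_def b'_def by (simp add: algebra_simps)
  have c2: "of_int 3 * of_int b = (2 * w + 1) * (of_int a :: 'b)" using c by (simp add: w_def N_def)
  have "of_int (3 * (a * b' - a' * b)) = (0 :: 'b)"
  proof -
    have s: "(2 * w + 1) * (2 * w + 1) = - (3 :: 'b)"
    proof -
      have "(2 * w + 1) * (2 * w + 1) = 4 * (1 + w + w ^ 2) - 3"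
        by (simp add: algebra_simps power2_eq_square)
      thus ?thesis using w_sum by simp
    qed
    have e: "of_int a' = - (of_int b' * (2 * w + 1) :: 'b)" using c1 by (simp add: eq_neg_iff_add_eq_0)
    have "of_int (3 * (a * b' - a' * b)) =
        3 * of_int a * of_int b' - of_int a' * (of_int 3 * of_int b :: 'b)" by (simp add: algebra_simps)
    also have "\<dots> = of_int a * of_int b' * (3 + (2 * w + 1) * (2 * w + 1))"
      unfolding c2 e by (simp add: algebra_simps)
    finally show ?thesis unfolding s by simp
  qed
  hence "int CARD('b) dvd 3 * (a * b' - a' * b)" using p by (simp only: of_int_eq_0_iff_char_dvd)
  moreover have "\<not> int CARD('b) dvd 3"
  proof
    assume "int CARD('b) dvd 3"
    hence "int CARD('b) \<le> 3" by (rule zdvd_imp_le) simp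
    thus False using card_eq N_pos by simp
  qed
  ultimately have "int CARD('b) dvd a * b' - a' * b"
    using p(1) prime_dvd_multD[of "int CARD('b)" 3 "a * b' - a' * b"] by simp
  hence "a = a' \<and> b = b'"
    using p(1) by (intro eisenstein_representation_unique[OF _ ab ab']) (use a a' in \<open>auto simp: prime_gt_0_nat\<close>)
  thus ?thesis using J by simp
qed

end

section \<open>Elements of given trace and cubic norm class\<close>

lemma (in prime_field_embedding) exists_conjugate_data:
  assumes x: "x ^ (q ^ t) = (x :: 'a)" and t: "t \<ge> 1"
  obtains e P where "P \<in> prime_monics e" "ev P x = 0" "e dvd t"
  using exists_prime_monic_root[OF x t] prime_monic_root_fixed_iff x by blast

context cubic_character_extension
begin

lemma iota_ff_trace: "x ^ (q ^ t) = x \<Longrightarrow> t \<ge> 1 \<Longrightarrow> \<iota> (iota_inv (ff_trace q t x)) = ff_trace q t x"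
  by (erule (1) exists_conjugate_data) (simp add: ff_trace_prime_monic_root)

lemma iota_ff_norm: "x ^ (q ^ t) = x \<Longrightarrow> t \<ge> 1 \<Longrightarrow> \<iota> (iota_inv (ff_norm q t x)) = ff_norm q t x"
  by (erule (1) exists_conjugate_data) (simp add: ff_norm_prime_monic_root)

lemma card_fixed_trace_le:
  assumes t: "t \<ge> 1"
  shows "card {x :: 'a. x ^ (q ^ t) = x \<and> ff_trace q t x = c} \<le> q ^ (t - 1)"
proof -
  obtain t' where t': "t = Suc t'" using t by (cases t) auto
  let ?f = "(\<Sum>j<t. monom 1 (q ^ j)) - [:c:] :: 'a poly"
  have "coeff ?f (q ^ t') = 1"
  proof -
    have "coeff ?f (q ^ t') = (\<Sum>j<t. if j = t' then 1 else 0) - coeff [:c:] (q ^ t')"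
      using q_ge_2 by (simp add: coeff_sum)
    also have "coeff [:c:] (q ^ t') = 0" using q_ge_2 by (cases "q ^ t'") auto
    finally show ?thesis using t' by simp
  qed
  hence f0: "?f \<noteq> 0" by (metis coeff_0 zero_neq_one)
  have "degree ?f \<le> q ^ t'"
  proof (intro degree_diff_le degree_sum_le)
    fix j assume "j \<in> {..<t}"
    thus "degree (monom (1 :: 'a) (q ^ j)) \<le> q ^ t'"
      using q_ge_2 t' by (simp add: degree_monom_eq power_increasing)
  qed auto
  have "card {x :: 'a. x ^ (q ^ t) = x \<and> ff_trace q t x = c} \<le> card {x. poly ?f x = 0}"
    by (intro card_mono) (auto simp: ff_trace_def poly_sum poly_monom)
  also have "\<dots> \<le> degree ?f" by (rule card_poly_roots_bound[OF f0])
  finally show ?thesis using \<open>degree ?f \<le> q ^ t'\<close> t' by simp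
qed

text \<open>No fibre of the trace exceeds the degree of the trace polynomial, so all fibres attain it.\<close>

lemma card_fixed_trace:
  assumes K: "card {x :: 'a. x ^ (q ^ t) = x} = q ^ t" and t: "t \<ge> 1"
  shows "card {x. x ^ (q ^ t) = x \<and> ff_trace q t x = \<iota> c} = q ^ (t - 1)"
proof -
  let ?A = "\<lambda>c. {x. x ^ (q ^ t) = x \<and> ff_trace q t x = \<iota> c}"
  have le: "card (?A c) \<le> q ^ (t - 1)" for c by (rule card_fixed_trace_le[OF t])
  have "{x. x ^ (q ^ t) = x} = (\<Union>c. ?A c)"   proof (intro equalityI subsetI)
    fix x :: 'a assume "x \<in> {x. x ^ (q ^ t) = x}"
    thus "x \<in> (\<Union>c. ?A c)" using iota_ff_trace[of x t] t by (auto intro!: exI[of _ "iota_inv (ff_trace q t x)"])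
  qed auto
  hence "q ^ t = card (\<Union>c. ?A c)" using K by simp
  also have "\<dots> = (\<Sum>c\<in>UNIV. card (?A c))" by (rule card_UN_disjoint) auto
  finally have "(\<Sum>c\<in>UNIV. card (?A c)) = (\<Sum>c\<in>(UNIV :: 'c mod_ring set). q ^ (t - 1))"
    using t q_eq by (simp flip: power_Suc)
  thus ?thesis by (rule sum_mono_inv) (rule le, simp_all)
qed

lemma ff_trace_zero: "ff_trace q t (0 :: 'a) = 0" and ff_norm_zero: "t \<ge> 1 \<Longrightarrow> ff_norm q t (0 :: 'a) = 0"
  using q_ge_2 by (auto simp: ff_trace_def ff_norm_def intro!: exI[of _ 0])

lemma card_fixed_trace_nonzero:
  assumes K: "card {x :: 'a. x ^ (q ^ t) = x} = q ^ t" and t: "t \<ge> 1"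
  shows "real (card {x. x ^ (q ^ t) = x \<and> ff_trace q t x = \<iota> c \<and> x \<noteq> 0}) =
    real q ^ (t - 1) - (if c = 0 then 1 else 0)"
proof -
  have z: "(0 :: 'a) ^ (q ^ t) = 0" using q_ge_2 by simp
  have eq: "{x. x ^ (q ^ t) = x \<and> ff_trace q t x = \<iota> c \<and> x \<noteq> 0} =
      {x. x ^ (q ^ t) = x \<and> ff_trace q t x = \<iota> c} - {0}" by auto
  have "card ({x. x ^ (q ^ t) = x \<and> ff_trace q t x = \<iota> c} - {0}) =
      q ^ (t - 1) - (if c = 0 then 1 else 0)"
    using card_fixed_trace[OF K t, of c] z by (auto simp: card_Diff_singleton_if ff_trace_zero)
  thus ?thesis unfolding eq using q_ge_2 by (simp add: of_nat_diff)
qed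

text \<open>A cube root of unity u has 1 + 2 Re u = 1 + u + u^2, which is 3 or 0. Here u is z
  divided by \<open>zeta3 ^ i\<close>, because \<open>zeta3 ^ (2 * i)\<close> is the inverse of
  \<open>zeta3 ^ i\<close>.\<close>

lemma indicator_zeta3:
  assumes "z = zeta3 ^ k"
  shows "1 + 2 * Re (zeta3 ^ (2 * i) * z) = (if z = zeta3 ^ i then 3 else 0)"
proof -
  have Re: "Re (zeta3 ^ j) = (if j mod 3 = 0 then 1 else - (1 / 2))" for j
  proof -
    have "j mod 3 = 0 \<or> j mod 3 = 1 \<or> j mod 3 = 2" by auto
    moreover have "Re zeta3 = - (1 / 2)" "Re (zeta3 ^ 2) = - (1 / 2)"
      by (auto simp: zeta3_eq complex_eq_iff power2_eq_square)
    ultimately show ?thesis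
      using power_mod_3[OF zeta3_cube, of j] by (auto simp flip: power_mod_3[OF zeta3_cube, of j])
  qed
  have "(2 * i + k) mod 3 = 0 \<longleftrightarrow> k mod 3 = i mod 3" by presburger
  thus ?thesis unfolding assms zeta3_power_eq_iff power_add[symmetric] Re by simp
qed

lemma card_fixed_trace_norm:
  assumes K: "card {x :: 'a. x ^ (q ^ t) = x} = q ^ t" and t: "t \<ge> 1"
    and zeta: "\<And>y. y \<noteq> 0 \<Longrightarrow> \<exists>k. \<chi> y = zeta3 ^ k"
  shows "3 * real (card {x. x ^ (q ^ t) = x \<and> ff_trace q t x = \<iota> c \<and> x \<noteq> 0 \<and>
      \<chi> (iota_inv (ff_norm q t x)) = zeta3 ^ i}) =
    real q ^ (t - 1) - (if c = 0 then 1 else 0) +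
    2 * Re (zeta3 ^ (2 * i) * ((- 1) ^ (t - 1) * Poly_Mapping.lookup (gauss ^ t) c))"
proof -
  let ?A = "{x. x ^ (q ^ t) = x \<and> ff_trace q t x = \<iota> c}"
  let ?B = "{x. x ^ (q ^ t) = x \<and> ff_trace q t x = \<iota> c \<and> x \<noteq> 0}"
  let ?\<psi> = "\<lambda>x. \<chi> (iota_inv (ff_norm q t x))"
  have "\<exists>k. ?\<psi> x = zeta3 ^ k" if x: "x \<in> ?B" for x
  proof (rule zeta)
    have "ff_norm q t x \<noteq> 0" using x by (auto simp: ff_norm_def)
    thus "iota_inv (ff_norm q t x) \<noteq> 0" using iota_ff_norm[of x t] x t by auto
  qed
  hence ind: "1 + 2 * Re (zeta3 ^ (2 * i) * ?\<psi> x) = (if ?\<psi> x = zeta3 ^ i then 3 else 0)" if "x \<in> ?B" for x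
    using that indicator_zeta3 by blast
  have "3 * real (card {x. x ^ (q ^ t) = x \<and> ff_trace q t x = \<iota> c \<and> x \<noteq> 0 \<and> ?\<psi> x = zeta3 ^ i}) =
      (\<Sum>x\<in>{x \<in> ?B. ?\<psi> x = zeta3 ^ i}. 3)" by (simp add: conj_ac)
  also have "\<dots> = (\<Sum>x\<in>?B. if ?\<psi> x = zeta3 ^ i then 3 else 0)" by (subst sum.inter_filter) auto
  also have "\<dots> = (\<Sum>x\<in>?B. 1 + 2 * Re (zeta3 ^ (2 * i) * ?\<psi> x))" by (intro sum.cong refl) (simp only: ind)
  also have "\<dots> = real (card ?B) + 2 * Re (zeta3 ^ (2 * i) * (\<Sum>x\<in>?B. ?\<psi> x))"
    by (simp add: sum.distrib sum_distrib_left)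
  \<comment> \<open>Putting x = 0 back changes nothing, since its norm is 0 and
    \<open>\<chi> 0 = 0\<close>.\<close>
  also have "(\<Sum>x\<in>?B. ?\<psi> x) = (\<Sum>x\<in>?A. ?\<psi> x)"
  proof (rule sum.mono_neutral_left)
    have "iota_inv 0 = 0" using iota_inv[of 0] by simp
    thus "\<forall>x\<in>?A - ?B. ?\<psi> x = 0" using ff_norm_zero[OF t] by auto
  qed auto
  finally show ?thesis unfolding card_fixed_trace_nonzero[OF K t] sum_chi_norm_fixed_trace[OF K t] .
qed

end

section \<open>Subfields, the prime field and norms of primitive elements\<close>

lemma is_subfield_power_card:
  fixes K :: "'a::finite_field set"
  assumes K: "is_subfield K" and x: "x \<in> K"
  shows "x ^ card K = x"
proof (cases "x = 0")
  case True
  have "K \<noteq> {}" using x by auto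
  thus ?thesis using True by (simp add: power_0_left card_eq_0_iff)
next
  case False
  have c: "card K = Suc (card (K - {0}))"
    using K by (intro card.remove) (auto simp: is_subfield_def)
  have "(\<Prod>y\<in>K - {0}. x * y) = (\<Prod>y\<in>K - {0}. y)"
    by (rule prod.reindex_bij_witness[of _ "\<lambda>y. inverse x * y" "\<lambda>y. x * y"])
       (use False K x in \<open>auto simp: is_subfield_def\<close>)
  hence "x ^ card (K - {0}) * (\<Prod>y\<in>K - {0}. y) = (\<Prod>y\<in>K - {0}. y)" by (simp add: prod.distrib)
  hence "x ^ card (K - {0}) = 1" by simp
  thus ?thesis unfolding c by simp
qed

text \<open>X^|K| - X has at most |K| roots, and the elements of K already supply that many.\<close>

lemma is_subfield_eq_fixed:
  fixes K :: "'a::finite_field set"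
  assumes K: "is_subfield K"
  shows "K = {x. x ^ card K = x}"
proof (rule card_seteq)
  show "K \<subseteq> {x. x ^ card K = x}" using is_subfield_power_card[OF K] by auto
  have "card {0, 1 :: 'a} \<le> card K" using K by (intro card_mono) (auto simp: is_subfield_def)
  hence c: "card K \<ge> 2" by simp
  let ?f = "monom 1 (card K) - monom 1 1 :: 'a poly"
  have "?f \<noteq> 0" using degree_Xpow_minus_X(1)[OF c, where 'b = 'a] c by (metis degree_0 not_numeral_le_zero)
  hence "card {x. poly ?f x = 0} \<le> card K"
    using card_poly_roots_bound degree_Xpow_minus_X(1)[OF c, where 'b = 'a] by metis
  thus "card {x :: 'a. x ^ card K = x} \<le> card K" by (simp add: poly_monom)
qed simp

text \<open>
  \<open>'a ring_char\<close> is a type with \<open>CHAR('a)\<close> elements, so \<open>'a ring_char mod_ring\<close> is the prime field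
  of \<open>'a\<close> as a type of its own, over which polynomials factor uniquely.
\<close>

definition prime_embedding :: "'a::finite_field ring_char mod_ring \<Rightarrow> 'a" where
  "prime_embedding x = of_int (to_int_mod_ring x)"

lemma prime_field_embedding_prime_embedding:
  "prime_field_embedding (prime_embedding :: 'a::finite_field ring_char mod_ring \<Rightarrow> 'a) CHAR('a)"
proof unfold_locales
  fix x y :: "'a ring_char mod_ring"
  show "prime_embedding (x + y) = (prime_embedding x + prime_embedding y :: 'a)"
    unfolding prime_embedding_def to_int_mod_ring_add CARD_ring_char of_int_mod_CHAR by simp
  show "prime_embedding (x * y) = (prime_embedding x * prime_embedding y :: 'a)"
    unfolding prime_embedding_def to_int_mod_ring_mult CARD_ring_char of_int_mod_CHAR by simp
qed (auto simp: prime_embedding_def)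

text \<open>Every subfield contains all integer multiples of 1, and these already number
  \<open>CHAR('a)\<close>.\<close>

lemma range_prime_embedding:
  fixes F :: "'a::finite_field set"
  assumes F: "is_subfield F" "card F = CHAR('a)"
  shows "range (prime_embedding :: 'a ring_char mod_ring \<Rightarrow> 'a) = F"
proof (rule card_seteq)
  have nat: "of_nat k \<in> F" for k
    using F(1) by (induction k) (auto simp: is_subfield_def)
  have "of_int k \<in> F" for k
  proof (cases "k \<ge> 0")
    case True
    thus ?thesis using nat[of "nat k"] by simp
  next
    case False
    hence "of_int k = - (of_nat (nat (- k)) :: 'a)" by simp
    thus ?thesis using nat[of "nat (- k)"] F(1) by (simp add: is_subfield_def)
  qed
  thus "range (prime_embedding :: 'a ring_char mod_ring \<Rightarrow> 'a) \<subseteq> F" by (auto simp: prime_embedding_def)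
  interpret prime_field_embedding "prime_embedding :: 'a ring_char mod_ring \<Rightarrow> 'a" "CHAR('a)"
    by (rule prime_field_embedding_prime_embedding)
  show "card F \<le> card (range (prime_embedding :: 'a ring_char mod_ring \<Rightarrow> 'a))"
    using F(2) inj_f by (subst card_image) (auto simp: CARD_mod_ring)
qed simp

lemma CHAR_of_card_prime_power:
  assumes p: "prime p" and card: "CARD('a::finite_field) = p ^ m"
  shows "CHAR('a) = p"
proof -
  have "CHAR('a) dvd p ^ m"
    using of_nat_card_eq_0[where 'b = 'a] card by (metis of_nat_eq_0_iff_char_dvd)
  moreover have P: "prime CHAR('a)" by (rule CHAR_prime)
  ultimately have "CHAR('a) dvd p" by (metis prime_dvd_power)
  thus ?thesis using p P by (metis primes_dvd_imp_eq)
qed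

text \<open>Negative exponents are absorbed by writing the inverse of \<open>\<gamma>\<close> as its
  power with exponent CARD - 2.\<close>

lemma primitive_element_power:
  fixes \<gamma> :: "'a::finite_field"
  assumes \<gamma>: "primitive_element \<gamma>" and x: "x \<noteq> 0"
  shows "\<exists>k::nat. x = \<gamma> ^ k"
proof -
  obtain k where k: "x = \<gamma> powi k" and \<gamma>0: "\<gamma> \<noteq> 0" using \<gamma> x by (auto simp: primitive_element_def)
  have "\<gamma> * \<gamma> ^ (CARD('a) - 2) = \<gamma> ^ (CARD('a) - 1)"
    using card_field_ge_2[where 'b = 'a] by (simp flip: power_Suc add: Suc_diff_Suc numeral_2_eq_2)
  hence "inverse \<gamma> = \<gamma> ^ (CARD('a) - 2)"
    using power_card_minus_1[OF \<gamma>0] by (intro inverse_unique) simp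
  hence "x = (if k \<ge> 0 then \<gamma> ^ nat k else \<gamma> ^ ((CARD('a) - 2) * nat (- k)))"
    unfolding k power_int_def by (simp add: power_mult)
  thus ?thesis by metis
qed

lemma ff_norm_power: "ff_norm p m x = x ^ (\<Sum>j<m. p ^ j)"
  by (simp add: ff_norm_def power_sum)

lemma geometric_sum_nat: "(p - 1) * (\<Sum>j<m. p ^ j) = p ^ m - (1 :: nat)"
proof (cases "p = 0")
  case True
  thus ?thesis by (cases m) auto
next
  case False
  then obtain r where r: "p = Suc r" by (cases p) auto
  have "r * (\<Sum>j<m. p ^ j) + 1 = p ^ m"
    by (induction m) (auto simp: r algebra_simps)
  thus ?thesis by (simp add: r)
qed

lemma norm_primitive_element_power:
  fixes \<gamma> :: "'a::finite_field"
  assumes card: "CARD('a) = p ^ m" and \<gamma>: "primitive_element \<gamma>"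
  shows "ff_norm p m \<gamma> ^ (p - 1) = 1"
proof -
  have "\<gamma> \<noteq> 0" using \<gamma> by (simp add: primitive_element_def)
  thus ?thesis using power_card_minus_1[of \<gamma>] geometric_sum_nat[of p m] card
    by (simp add: ff_norm_power mult.commute flip: power_mult)
qed

text \<open>With x = \<open>\<gamma> ^ k\<close> and x^(p-1) = 1, p^m - 1 divides k (p - 1).
  Cancelling p - 1, k is a multiple of 1 + p + ... + p^(m-1), the exponent of the norm.\<close>

lemma norm_primitive_element_generates:
  fixes \<gamma> :: "'a::finite_field"
  assumes p: "p > 1" and card: "CARD('a) = p ^ m" and \<gamma>: "primitive_element \<gamma>"
    and x: "x \<noteq> 0" "x ^ p = x"
  shows "\<exists>k::nat. x = ff_norm p m \<gamma> ^ k"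
proof -
  have \<gamma>0: "\<gamma> \<noteq> 0" using \<gamma> by (simp add: primitive_element_def)
  obtain k where k: "x = \<gamma> ^ k" using primitive_element_power[OF \<gamma> x(1)] by blast
  have "x * x ^ (p - 1) = x * 1" using x(2) p by (simp flip: power_Suc)
  hence "\<gamma> ^ (k * (p - 1)) = 1" using x(1) by (simp add: k power_mult \<gamma>0)
  hence "(CARD('a) - 1) dvd k * (p - 1)"
    using primitive_element_power[OF \<gamma>] power_card_minus_1[OF \<gamma>0]
    by (intro generator_power_eq_1_imp_dvd)
  hence "(\<Sum>j<m. p ^ j) * (p - 1) dvd k * (p - 1)"
    using geometric_sum_nat[of p m] card by (simp add: mult.commute)
  hence "(\<Sum>j<m. p ^ j) dvd k" using p by simp
  then obtain l where "k = (\<Sum>j<m. p ^ j) * l" by (elim dvdE)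
  thus ?thesis by (auto simp: k ff_norm_power power_mult)
qed

section \<open>From the count over F_(p^t) to trace and norm of the whole field\<close>

theorem theorem3:
  fixes p m t h d i\<^sub>0 :: nat
    and F\<^sub>p F\<^sub>t :: "'a::finite_field set"
    and \<gamma> g a a\<^sub>0 :: 'a
    and \<chi>\<^sub>3 :: "'a \<Rightarrow> complex"
    and a\<^sub>3 b\<^sub>3 :: int
    and \<pi>\<^sub>3 :: complex
  assumes "prime p" and "[p = 1] (mod 3)"
    and "m \<ge> 2" and "CARD('a) = p ^ m"
    and "is_subfield F\<^sub>p" and "card F\<^sub>p = p"
    and "t dvd m" and "is_subfield F\<^sub>t" and "card F\<^sub>t = p ^ t"
    and "primitive_element \<gamma>" and "g = ff_norm p m \<gamma>"
    and "mult_character F\<^sub>p \<chi>\<^sub>3" and "character_order F\<^sub>p \<chi>\<^sub>3 = 3" and "\<chi>\<^sub>3 g = zeta3"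
    and "a\<^sub>3\<^sup>2 + 3 * b\<^sub>3\<^sup>2 = int p" and "[a\<^sub>3 = - 1] (mod 3)"
    and "of_int (3 * b\<^sub>3) = (2 * g ^ ((p - 1) div 3) + 1) * of_int a\<^sub>3"
    and "\<pi>\<^sub>3 = \<chi>\<^sub>3 2 * (of_int a\<^sub>3 + \<i> * of_int b\<^sub>3 * of_real (sqrt 3))"
    and "h \<in> {0, 1, 2}" and "a \<in> F\<^sub>p"
    and "d = gcd (m div t) 3" and "\<not> p dvd m div t" and "d dvd h"
    and "i\<^sub>0 < 3 div d" and "[m div (d * t) * i\<^sub>0 = h div d] (mod (3 div d))"
    and "a \<noteq> 0 \<Longrightarrow> a\<^sub>0 = - (of_nat (m div t) / a)"
  shows "(a = 0 \<and> \<not> 3 dvd m div t \<and> \<not> 3 dvd t \<longrightarrow>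
            real (N_count p m g 3 h a F\<^sub>t) = 1/3 * (real p ^ (t - 1) - 1)) \<and>
         (a = 0 \<and> \<not> 3 dvd m div t \<and> 3 dvd t \<longrightarrow>
            real (N_count p m g 3 h a F\<^sub>t) =
              1/3 * (real p ^ (t - 1) - 1
                     - 2 * (- 1) ^ t * real p ^ ((t - 3) div 3) * (real p - 1)
                         * Re (\<pi>\<^sub>3 ^ (t div 3) * zeta3 ^ (2 * i\<^sub>0)))) \<and>
         (a = 0 \<and> 3 dvd m div t \<longrightarrow>
            real (N_count p m g 3 h a F\<^sub>t) = real p ^ (t - 1) - 1) \<and>
         (a \<noteq> 0 \<and> \<not> 3 dvd m div t \<and> \<not> 3 dvd t \<longrightarrow>
            real (N_count p m g 3 h a F\<^sub>t) =
              1/3 * (real p ^ (t - 1) - 2 * (- 1) ^ t * Re (Q3 p \<pi>\<^sub>3 \<chi>\<^sub>3 a\<^sub>0 i\<^sub>0 t))) \<and>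
         (a \<noteq> 0 \<and> \<not> 3 dvd m div t \<and> 3 dvd t \<longrightarrow>
            real (N_count p m g 3 h a F\<^sub>t) =
              1/3 * (real p ^ (t - 1)
                     + 2 * (- 1) ^ t * real p ^ ((t - 3) div 3)
                         * Re (\<pi>\<^sub>3 ^ (t div 3) * zeta3 ^ (2 * i\<^sub>0)))) \<and>
         (a \<noteq> 0 \<and> 3 dvd m div t \<longrightarrow>
            real (N_count p m g 3 h a F\<^sub>t) = real p ^ (t - 1))"
proof -
  note prime = assms(1) and cong_p = assms(2) and card = assms(4) and Fp = assms(5,6)
    and Ft = assms(8,9) and gam = assms(10) and g_def = assms(11) and chi = assms(12)
    and chi_g = assms(14)
  let ?i = "prime_embedding :: 'a ring_char mod_ring \<Rightarrow> 'a"
  let ?n = "m div t"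
  have CHAR: "CHAR('a) = p" by (rule CHAR_of_card_prime_power[OF prime card])
  have p1: "p > 1" using prime prime_gt_1_nat by blast
  have range: "range ?i = F\<^sub>p" using Fp CHAR by (intro range_prime_embedding) auto
  have Fp_eq: "F\<^sub>p = {x. x ^ p = x}" using is_subfield_eq_fixed[OF Fp(1)] Fp(2) by simp
  have Ft_eq: "F\<^sub>t = {x. x ^ (p ^ t) = x}" using is_subfield_eq_fixed[OF Ft(1)] Ft(2) by simp
  have m: "m = t * ?n" using \<open>t dvd m\<close> by simp
  have t: "t \<ge> 1" using \<open>t dvd m\<close> \<open>m \<ge> 2\<close> by (cases t) auto
  have K: "card {x :: 'a. x ^ (p ^ t) = x} = p ^ t" using Ft(2) Ft_eq by simp
  have gp: "g ^ (p - 1) = 1" unfolding g_def by (rule norm_primitive_element_power[OF card gam])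
  hence g0: "g \<noteq> 0" using p1 by (auto simp: power_0_left)
  have "g ^ p = g * g ^ (p - 1)" using p1 by (simp flip: power_Suc)
  hence gF: "g \<in> F\<^sub>p" using gp by (simp add: Fp_eq)
  then obtain g' where g': "?i g' = g" using range by force
  have Fp_powers: "\<exists>k::nat. x = g ^ k" if "x \<in> F\<^sub>p" "x \<noteq> 0" for x
    unfolding g_def by (rule norm_primitive_element_generates[OF p1 card gam]) (use that Fp_eq in auto)

  interpret E: prime_field_embedding ?i p
    using prime_field_embedding_prime_embedding[where 'a = 'a] by (simp add: CHAR)
  have g'0: "g' \<noteq> 0" using g' g0 by auto
  have gen: "\<exists>k. y = g' ^ k" if "y \<noteq> 0" for y
  proof -
    have "?i y \<in> F\<^sub>p" "?i y \<noteq> 0" using that range by auto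
    then obtain k where "?i y = g ^ k" using Fp_powers by blast
    hence "?i y = ?i (g' ^ k)" by (simp add: E.hom_power g')
    thus ?thesis using E.inj_f by (auto dest: injD)
  qed
  define \<chi> where "\<chi> = (\<lambda>y. \<chi>\<^sub>3 (?i y))"
  have chi_i: "\<chi>\<^sub>3 (?i y) = \<chi> y" for y by (simp add: \<chi>_def)
  have chi_mult: "\<chi> (x * y) = \<chi> x * \<chi> y" for x y
    using chi range by (auto simp: \<chi>_def mult_character_def E.hom_mult)
  have chi0: "\<chi> 0 = 0" and chi1: "\<chi> 1 = 1" using chi by (auto simp: \<chi>_def mult_character_def)
  have chi_g': "\<chi> g' = zeta3" using chi_g by (simp add: \<chi>_def g')
  have chi_g'_power: "\<chi> (g' ^ k) = zeta3 ^ k" for k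
    by (induction k) (simp_all add: chi1 chi_mult chi_g')
  have zeta: "\<exists>k. \<chi> y = zeta3 ^ k" if "y \<noteq> 0" for y
    using gen[OF that] chi_g'_power by metis
  interpret C: cubic_character_extension ?i p \<chi>
  proof unfold_locales
    fix y :: "'a ring_char mod_ring" assume "y \<noteq> 0"
    then obtain k where "\<chi> y = zeta3 ^ k" using zeta by blast
    hence "\<chi> y ^ 3 = (zeta3 ^ 3) ^ k" by (simp add: power_mult[symmetric] mult.commute)
    thus "\<chi> y ^ 3 = 1" by (simp add: zeta3_cube)
  next
    show "\<exists>x. x \<noteq> 0 \<and> \<chi> x \<noteq> 1" using g'0 chi_g' zeta3_neq_1 by auto
  qed (simp_all add: chi0 chi1 chi_mult)
  have CARD: "CARD('a ring_char mod_ring) = p" by (simp add: CHAR CARD_mod_ring)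
  have CHAR': "CHAR('a ring_char mod_ring) = p" by (simp add: CHAR)
  have p3: "p > 3"
  proof -
    have "p mod 3 = 1" using cong_p by (simp add: cong_def)
    moreover have "p \<noteq> 2" "p \<noteq> 3" using \<open>p mod 3 = 1\<close> by auto
    ultimately show ?thesis using p1 by linarith
  qed
  interpret G: cubic_character_generator \<chi> g'
  proof unfold_locales
    show "(2 :: 'a ring_char mod_ring) \<noteq> 0"
    proof
      assume "(2 :: 'a ring_char mod_ring) = 0"
      hence "of_nat 2 = (0 :: 'a ring_char mod_ring)" by simp
      hence "p dvd 2" unfolding of_nat_eq_0_iff_char_dvd CHAR' .
      thus False using p3 by (auto dest: dvd_imp_le)
    qed
  qed (use gen g'0 chi_g' in auto)
  have pi: "C.jacobi = \<pi>\<^sub>3"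
  proof -
    have "?i (of_int (3 * b\<^sub>3)) = ?i ((2 * g' ^ ((p - 1) div 3) + 1) * of_int a\<^sub>3)"
      using assms(17) by (simp add: hom_distribs g')
    hence "of_int (3 * b\<^sub>3) = (2 * g' ^ ((p - 1) div 3) + 1) * (of_int a\<^sub>3 :: 'a ring_char mod_ring)"
      using E.inj_f by (auto dest: injD)
    hence "C.jacobi = \<chi> 2 * (of_int a\<^sub>3 + \<i> * of_int b\<^sub>3 * of_real (sqrt 3))"
      using prime assms(15,16) by (intro G.jacobi_eq) (simp_all only: CARD CHAR')
    moreover have "\<chi> 2 = \<chi>\<^sub>3 2" by (simp add: \<chi>_def E.hom_numeral)
    ultimately show ?thesis using assms(18) by simp
  qed

  have n0: "of_nat ?n \<noteq> (0 :: 'a)"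
    using assms(22) by (simp add: of_nat_eq_0_iff_char_dvd CHAR)
  \<comment> \<open>The prescribed trace from F_(p^t); dividing by m/t is possible because p does
    not divide it.\<close>
  obtain c where c: "?i c = a / of_nat ?n"
  proof -
    have "inverse (of_nat ?n) \<in> F\<^sub>p" using Fp(1) range E.hom_of_nat[of ?n]
      by (metis is_subfield_def rangeI)
    hence "a / of_nat ?n \<in> F\<^sub>p" using Fp(1) \<open>a \<in> F\<^sub>p\<close> by (simp add: is_subfield_def divide_inverse)
    thus ?thesis using that range by force
  qed
  have c0: "c = 0 \<longleftrightarrow> a = 0" using c n0 by (metis E.hom_0_iff divide_eq_0_iff)
  let ?\<psi> = "\<lambda>x. \<chi> (E.iota_inv (ff_norm p t x))"
  have coset: "y \<in> power_coset g 3 h \<longleftrightarrow> y \<noteq> 0 \<and> \<chi>\<^sub>3 y = zeta3 ^ h" if y: "y \<in> F\<^sub>p" for y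
  proof
    assume "y \<in> power_coset g 3 h"
    then obtain k :: int where k: "y = g ^ h * (g ^ 3) powi k" by (auto simp: power_coset_def)
    \<comment> \<open>The integer exponent k may be negative; as \<open>g powi k\<close> is fixed by
      Frobenius, it is also a natural power of g, to which the character can be applied.\<close>
    have "(g powi k) ^ p = (g ^ p) powi k"
      unfolding power_int_power power_int_power' by (simp add: mult.commute)
    hence "g powi k \<in> F\<^sub>p" using gF by (simp add: Fp_eq)
    then obtain j where j: "g powi k = g ^ j" using Fp_powers g0 by force
    have "(g ^ 3) powi k = (g powi k) ^ 3"
      unfolding power_int_power power_int_power' by (simp add: mult.commute)
    hence y: "y = ?i (g' ^ (h + 3 * j))"
      unfolding k j by (simp add: hom_distribs g' power_add power_mult mult.commute)
    have "\<chi>\<^sub>3 y = zeta3 ^ (h + 3 * j)" unfolding y chi_i by (rule chi_g'_power)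
    moreover have "zeta3 ^ (h + 3 * j) = zeta3 ^ h" unfolding zeta3_power_eq_iff by simp
    moreover have "y \<noteq> 0" unfolding k using g0 by simp
    ultimately show "y \<noteq> 0 \<and> \<chi>\<^sub>3 y = zeta3 ^ h" by simp
  next
    assume y': "y \<noteq> 0 \<and> \<chi>\<^sub>3 y = zeta3 ^ h"
    then obtain j where j: "y = g ^ j" using Fp_powers y by blast
    hence "y = ?i (g' ^ j)" by (simp add: E.hom_power g')
    hence "zeta3 ^ j = zeta3 ^ h" using y' chi_g'_power[of j] by (simp only: chi_i)
    hence "j mod 3 = h mod 3" by (simp add: zeta3_power_eq_iff)
    hence "\<exists>k. int j = int h + 3 * k" by presburger
    then obtain k where k: "int j = int h + 3 * k" by blast
    have "y = g powi (int j)" by (simp add: j)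
    also have "\<dots> = g ^ h * (g ^ 3) powi k"
      unfolding k power_int_power using g0 by (simp add: power_int_add)
    finally have "y = g ^ h * (g ^ 3) powi k" .
    thus "y \<in> power_coset g 3 h" by (auto simp: power_coset_def)
  qed
  have N: "N_count p m g 3 h a F\<^sub>t =
      card {x. x ^ (p ^ t) = x \<and> ff_trace p t x = ?i c \<and> x \<noteq> 0 \<and> ?\<psi> x ^ ?n = zeta3 ^ h}"
  proof -
    have "ff_trace p m x = a \<and> ff_norm p m x \<in> power_coset g 3 h \<longleftrightarrow>
        ff_trace p t x = ?i c \<and> x \<noteq> 0 \<and> ?\<psi> x ^ ?n = zeta3 ^ h" if x: "x ^ (p ^ t) = x" for x
    proof -
      have tr: "ff_trace p m x = of_nat ?n * ff_trace p t x"
        using ff_trace_periodic[OF x, of ?n] m by simp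
      have nm: "ff_norm p m x = ?i (E.iota_inv (ff_norm p t x) ^ ?n)"
        using ff_norm_periodic[OF x, of ?n] m C.iota_ff_norm[OF x t] by (simp add: E.hom_power)
      have "ff_norm p m x \<in> F\<^sub>p" using nm range by auto
      moreover have "\<chi>\<^sub>3 (ff_norm p m x) = ?\<psi> x ^ ?n"
        unfolding nm chi_i C.chi_power ..
      moreover have "ff_norm p m x = 0 \<longleftrightarrow> x = 0"
        using p1 assms(3) by (auto simp: ff_norm_def power_0_left intro!: exI[of _ 0])
      moreover have "ff_trace p m x = a \<longleftrightarrow> ff_trace p t x = ?i c"
        unfolding tr c using n0 by (auto simp: field_simps)
      ultimately show ?thesis using coset by auto
    qed
    thus ?thesis unfolding N_count_def Ft_eq by (intro arg_cong[where f = card]) auto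
  qed
  have psi_zeta: "\<exists>k. ?\<psi> x = zeta3 ^ k" if x: "x ^ (p ^ t) = x" "x \<noteq> 0" for x
  proof (rule zeta)
    have "ff_norm p t x \<noteq> 0" using x by (auto simp: ff_norm_def)
    thus "E.iota_inv (ff_norm p t x) \<noteq> 0" using C.iota_ff_norm[OF x(1) t] by auto
  qed
  show ?thesis
  proof (cases "3 dvd ?n")
    case True
    \<comment> \<open>Here d = 3 divides h < 3, so h = 0, and the cubic condition on a (m/t)-th
      power is met by every nonzero element.\<close>
    hence d3: "d = 3" using assms(21) by (simp add: gcd_nat.absorb2)
    hence h0: "h = 0" using assms(19,23) by auto
    have "?\<psi> x ^ ?n = zeta3 ^ h" if x: "x ^ (p ^ t) = x" "x \<noteq> 0" for x
    proof -
      obtain k where "?\<psi> x = zeta3 ^ k" using psi_zeta[OF x] by blast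
      moreover obtain l where "?n = 3 * l" using True by (elim dvdE)
      ultimately have "?\<psi> x ^ ?n = (zeta3 ^ 3) ^ (l * k)" by (simp add: power_mult[symmetric] mult_ac)
      thus ?thesis by (simp add: zeta3_cube h0)
    qed
    hence "N_count p m g 3 h a F\<^sub>t = card {x. x ^ (p ^ t) = x \<and> ff_trace p t x = ?i c \<and> x \<noteq> 0}"
      unfolding N by (intro arg_cong[where f = card]) auto
    hence "real (N_count p m g 3 h a F\<^sub>t) = real p ^ (t - 1) - (if a = 0 then 1 else 0)"
      using C.card_fixed_trace_nonzero[OF K t, of c] c0 by simp
    thus ?thesis using True by auto
  next
    case False
    have coprime: "gcd ?n 3 = 1"
    proof -
      have "prime (3 :: nat)" by simp
      hence "gcd ?n 3 = 1 \<or> gcd ?n 3 = 3" using gcd_dvd2 prime_nat_iff by blast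
      thus ?thesis using False gcd_dvd1 by metis
    qed
    hence d1: "d = 1" using assms(21) by simp
    hence i0: "[?n * i\<^sub>0 = h] (mod 3)" using assms(25) by simp
    \<comment> \<open>As m/t is invertible modulo 3, i_0 is the unique class that multiplication by
      m/t carries to h.\<close>
    have "?\<psi> x ^ ?n = zeta3 ^ h \<longleftrightarrow> ?\<psi> x = zeta3 ^ i\<^sub>0" if x: "x ^ (p ^ t) = x" "x \<noteq> 0" for x
    proof -
      obtain k where k: "?\<psi> x = zeta3 ^ k" using psi_zeta[OF x] by blast
      have "?\<psi> x ^ ?n = zeta3 ^ h \<longleftrightarrow> [?n * k = h] (mod 3)"
        unfolding k by (simp add: zeta3_power_eq_iff cong_def mult.commute flip: power_mult)
      also have "\<dots> \<longleftrightarrow> [?n * k = ?n * i\<^sub>0] (mod 3)" using i0 by (meson cong_sym cong_trans)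
      also have "\<dots> \<longleftrightarrow> [k = i\<^sub>0] (mod 3)"
        by (rule cong_mult_lcancel_nat[OF gcd_eq_1_imp_coprime[OF coprime]])
      finally show ?thesis unfolding k by (simp add: zeta3_power_eq_iff cong_def)
    qed
    hence "N_count p m g 3 h a F\<^sub>t = card {x. x ^ (p ^ t) = x \<and> ff_trace p t x = ?i c \<and> x \<noteq> 0 \<and> ?\<psi> x = zeta3 ^ i\<^sub>0}"
      unfolding N by (intro arg_cong[where f = card]) auto
    hence N3: "real (N_count p m g 3 h a F\<^sub>t) = 1/3 * (real p ^ (t - 1) - (if a = 0 then 1 else 0) +
        2 * Re (zeta3 ^ (2 * i\<^sub>0) * ((- 1) ^ (t - 1) * Poly_Mapping.lookup (C.gauss ^ t) c)))"
      using C.card_fixed_trace_norm[OF K t zeta, of c i\<^sub>0] c0 by simp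
    have sign: "(- 1) ^ (t - 1) = (- ((- 1) ^ t) :: complex)"
      using t by (cases t) auto
    have Re_scale: "Re (of_real r * z) = r * Re z" for r z by simp
    have real_part: "Re (zeta3 ^ (2 * i\<^sub>0) * ((- 1) ^ (t - 1) * z)) = - ((- 1) ^ t) * Re (z * zeta3 ^ (2 * i\<^sub>0))" for z
    proof -
      have "zeta3 ^ (2 * i\<^sub>0) * ((- 1) ^ (t - 1) * z) = of_real (- ((- 1) ^ t)) * (z * zeta3 ^ (2 * i\<^sub>0))"
        unfolding sign by simp
      thus ?thesis by (simp only: Re_scale)
    qed
    have N4: "real (N_count p m g 3 h a F\<^sub>t) = 1/3 * (real p ^ (t - 1) - (if a = 0 then 1 else 0) -
        2 * (- 1) ^ t * Re (Poly_Mapping.lookup (C.gauss ^ t) c * zeta3 ^ (2 * i\<^sub>0)))"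
      unfolding N3 real_part by simp
    have L: "Poly_Mapping.lookup (C.gauss ^ t) c =
      (if t mod 3 = 1 then (of_nat p * \<pi>\<^sub>3) ^ ((t - 1) div 3) * \<chi> c
       else if t mod 3 = 2 then (of_nat p * \<pi>\<^sub>3) ^ ((t - 2) div 3) * \<pi>\<^sub>3 * \<chi> c ^ 2
       else (of_nat p * \<pi>\<^sub>3) ^ ((t - 3) div 3) * \<pi>\<^sub>3 * (if c = 0 then of_nat p - 1 else - 1))"
      using C.lookup_gauss_power[OF t, of c] unfolding CARD pi .
    show ?thesis
    proof (cases "3 dvd t")
      case t3: True
      \<comment> \<open>With t = 3 k + 3 the factor (p J)^k J supplies p^((t-3)/3) and the power t/3
        of \<open>\<pi>\<^sub>3\<close>.\<close>
      then obtain k where k: "t = 3 * k + 3"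
        using t by (metis add.commute dvdE mult_Suc_right not_one_le_zero mult_0_right not0_implies_Suc)
      have "Poly_Mapping.lookup (C.gauss ^ t) c * zeta3 ^ (2 * i\<^sub>0) =
          of_real (real p ^ k * (if a = 0 then real p - 1 else - 1)) * (\<pi>\<^sub>3 ^ (k + 1) * zeta3 ^ (2 * i\<^sub>0))"
        unfolding L using k c0 by (simp add: power_mult_distrib)
      hence "Re (Poly_Mapping.lookup (C.gauss ^ t) c * zeta3 ^ (2 * i\<^sub>0)) =
          real p ^ k * (if a = 0 then real p - 1 else - 1) * Re (\<pi>\<^sub>3 ^ (k + 1) * zeta3 ^ (2 * i\<^sub>0))"
        by (simp only: Re_scale)
      moreover have "t div 3 = k + 1" "(t - 3) div 3 = k" using k by auto
      ultimately show ?thesis using False t3 N4 by auto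
    next
      case t3: False
      show ?thesis
      proof (cases "a = 0")
        case True
        moreover have "t mod 3 = 1 \<or> t mod 3 = 2" using t3 by presburger
        ultimately have "Poly_Mapping.lookup (C.gauss ^ t) c = 0"
          unfolding L using c0 chi0 by auto
        thus ?thesis using False t3 N4 True by simp
      next
        case a: False
        \<comment> \<open>Since a_0 = -1/c, the value of the character at a_0 is the conjugate of
          its value at c; this is why the conjugation in \<open>Q3\<close> appears for t congruent
          to 1 and not to 2.\<close>
        have "a\<^sub>0 = ?i (- inverse c)"
          using assms(26)[OF a] by (simp add: hom_distribs c)
        hence "\<chi>\<^sub>3 a\<^sub>0 = \<chi> c ^ 2" by (simp only: chi_i C.chi_minus C.chi_inverse)
        moreover have "cnj (\<chi> c ^ 2) = \<chi> c" by (metis C.cnj_chi complex_cnj_cnj)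
        moreover have "t mod 3 = 1 \<or> t mod 3 = 2" using t3 by presburger
        moreover have "(t + 1) div 3 = Suc ((t - 2) div 3)" if "t mod 3 = 2" using that by presburger
        ultimately have "Poly_Mapping.lookup (C.gauss ^ t) c * zeta3 ^ (2 * i\<^sub>0) = Q3 p \<pi>\<^sub>3 \<chi>\<^sub>3 a\<^sub>0 i\<^sub>0 t"
          unfolding L Q3_def by (auto simp: power_mult_distrib)
        thus ?thesis using False t3 N4 a by simp
      qed
    qed
  qed
qed

end
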